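(* There exists an absolute constant $c>0$ such that the following holds. Let $\mu\in\mathbb{R}^n$, $\sigma>0$, $\xi\sim\mathcal{N}(0,\sigma^2I_{n\times n})$ and $y=\mu+\xi$. Then for all $x>0$, with probability at least $1-e^{-x}$, $$\|\hat\mu^{LS}(\mathcal{U})-\mu\|\le\min_{u\in\mathcal{U}}\left[\|u-\mu\|+2c\,\sigma\left(\frac{\sigma+V(u)}{\sigma n}\right)^{1/3}\right]+\frac{2(2+\sqrt2)\,\sigma\sqrt{x+\log(en)}}{\sqrt n}.$$
   Context: Scaled norm: $\|v\|^2=\frac1n\sum_{i=1}^n v_i^2$ for $v\in\mathbb{R}^n$. $\mathcal{U}=\bigcup_{m=1}^nK_m$ is the set of unimodal sequences in $\mathbb{R}^n$, where $K_m=\{u\in\mathbb{R}^n: u_1\ge\dots\ge u_m\le u_{m+1}\le\dots\le u_n\}$. $V(u)=\max_iu_i-\min_iu_i$. The least squares estimator over a nonempty closed (possibly non-convex) set $K$ is any $\hat\mu^{LS}(K)\in\operatorname{argmin}_{v\in K}\|y-v\|^2$. *)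

theory Defs
  imports "HOL-Probability.Probability"
begin

text \<open>Vectors of length \<open>n\<close> are functions that are extensional on the index set \<open>{1..n}\<close>,
  so that the dimension is an ordinary natural number; an absolute constant can then be
  chosen before \<open>n\<close>.\<close>

definition rvec :: "nat \<Rightarrow> (nat \<Rightarrow> real) set" where
  "rvec n = PiE {1..n} (\<lambda>_. UNIV)"

definition snorm :: "nat \<Rightarrow> (nat \<Rightarrow> real) \<Rightarrow> real" where
  "snorm n v = sqrt ((1 / real n) * (\<Sum>i=1..n. (v i)\<^sup>2))"

definition unimodal_at :: "nat \<Rightarrow> nat \<Rightarrow> (nat \<Rightarrow> real) set" where
  "unimodal_at n m =
     {u \<in> rvec n. (\<forall>i\<in>{1..<m}. u i \<ge> u (i + 1)) \<and> (\<forall>i\<in>{m..<n}. u i \<le> u (i + 1))}"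

definition unimodal :: "nat \<Rightarrow> (nat \<Rightarrow> real) set" where
  "unimodal n = (\<Union>m\<in>{1..n}. unimodal_at n m)"

definition variation :: "nat \<Rightarrow> (nat \<Rightarrow> real) \<Rightarrow> real" where
  "variation n u = Max (u ` {1..n}) - Min (u ` {1..n})"

text \<open>No measurability is required of the selection of a minimiser.\<close>

definition is_lse :: "nat \<Rightarrow> (nat \<Rightarrow> real) set \<Rightarrow> ((nat \<Rightarrow> real) \<Rightarrow> (nat \<Rightarrow> real)) \<Rightarrow> bool" where
  "is_lse n K est \<longleftrightarrow>
     (\<forall>y\<in>rvec n. is_arg_min (\<lambda>v. (snorm n (\<lambda>i. y i - v i))\<^sup>2) (\<lambda>v. v \<in> K) (est y))"

text \<open>The law \<open>N(0, \<sigma>\<^sup>2 I)\<close>; the second parameter of \<^const>\<open>normal_density\<close> is the standard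
  deviation.\<close>

definition gauss :: "nat \<Rightarrow> real \<Rightarrow> (nat \<Rightarrow> real) measure" where
  "gauss n \<sigma> = (\<Pi>\<^sub>M i\<in>{1..n}. density lborel (normal_density 0 \<sigma>))"

text \<open>\<open>P\<close> holds on a measurable event of probability at least \<open>p\<close>. If \<open>{\<omega> \<in> space M. P \<omega>}\<close> is
  measurable, this says that its probability is at least \<open>p\<close>; the inner formulation is needed
  because \<open>P\<close> may involve a non-measurable selection, and \<^const>\<open>measure\<close> is \<open>0\<close> on
  non-measurable sets.\<close>

definition with_prob_at_least :: "'a measure \<Rightarrow> real \<Rightarrow> ('a \<Rightarrow> bool) \<Rightarrow> bool" where
  "with_prob_at_least M p P \<longleftrightarrow> (\<exists>A\<in>sets M. measure M A \<ge> p \<and> (\<forall>\<omega>\<in>A. P \<omega>))"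

end

theory Submission
  imports Defs
begin

text \<open>
  Comparing the least squares criterion at the estimator \<open>v\<close> and at a competitor \<open>u\<close> reduces the
  claim to a bound on \<open>\<langle>\<xi>, v - u\<rangle>\<close>, uniform over unimodal \<open>v\<close>. Expand in the Haar basis. The
  coefficients of \<open>w = v - u\<close> have square sum \<open>\<parallel>w\<parallel>\<^sup>2\<close>, and at each level those away from \<open>1\<close>, \<open>n\<close>
  and the mode \<open>m\<close> of \<open>v\<close> have a small absolute sum, because there \<open>v\<close> is monotone and stays close
  to the range of \<open>u\<close>. Split each noise coefficient as \<open>|z| \<le> s + max 0 (|z| - s)\<close>: the thresholds
  \<open>s\<close> pair with the absolute sums, the excesses pair with \<open>\<parallel>w\<parallel>\<close> by the Cauchy-Schwarz inequality.
  With thresholds growing linearly in the level beyond a resolution \<open>\<rho>\<close>, the exponential moment of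
  the summed squared excesses is of order \<open>exp (n / 2 ^ \<rho>)\<close> up to logarithmic terms in the exponent;
  this yields the deviation bound without a Gaussian concentration inequality and without the
  logarithmic loss of a plain union bound. A union bound over \<open>m\<close> costs \<open>ln n\<close>, and all remaining
  logarithms are absorbed by the rate \<open>n powr (- 1 / 3)\<close>. The infimum over \<open>u\<close> is handled by a
  near-minimiser, at the price of doubling the constant.
\<close>

section \<open>Exponential moments of Gaussian coefficients\<close>

abbreviation centred_normal :: "real \<Rightarrow> real measure" where
  "centred_normal \<sigma> \<equiv> density lborel (normal_density 0 \<sigma>)"

lemma nn_integral_normal_density:
  assumes "0 < \<sigma>"
  shows "(\<integral>\<^sup>+ x. ennreal (normal_density m \<sigma> x) \<partial>lborel) = 1"
  using assms by (subst nn_integral_eq_integral) auto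

lemma nn_integral_normal_exp:
  assumes "0 < \<sigma>"
  shows "(\<integral>\<^sup>+ x. ennreal (exp (a * x)) \<partial>centred_normal \<sigma>) = ennreal (exp (\<sigma>\<^sup>2 * a\<^sup>2 / 2))"
proof -
  \<comment> \<open>Completing the square: the exponential tilt only moves the mean to
    \<open>\<sigma>\<^sup>2 * a\<close>.\<close>
  have eq: "normal_density 0 \<sigma> x * exp (a * x) =
      exp (\<sigma>\<^sup>2 * a\<^sup>2 / 2) * normal_density (\<sigma>\<^sup>2 * a) \<sigma> x" for x
    using assms unfolding normal_density_def
    by (simp add: exp_add[symmetric] field_simps power2_eq_square)
  have "(\<integral>\<^sup>+ x. ennreal (exp (a * x)) \<partial>centred_normal \<sigma>) =
      (\<integral>\<^sup>+ x. ennreal (normal_density 0 \<sigma> x) * ennreal (exp (a * x)) \<partial>lborel)"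
    by (subst nn_integral_density) auto
  also have "\<dots> = (\<integral>\<^sup>+ x. ennreal (exp (\<sigma>\<^sup>2 * a\<^sup>2 / 2)) * ennreal (normal_density (\<sigma>\<^sup>2 * a) \<sigma> x) \<partial>lborel)"
    by (simp add: eq flip: ennreal_mult)
  also have "\<dots> = ennreal (exp (\<sigma>\<^sup>2 * a\<^sup>2 / 2))"
    using assms by (simp add: nn_integral_cmult nn_integral_normal_density)
  finally show ?thesis .
qed

lemma nn_integral_std_normal_exp_square:
  "(\<integral>\<^sup>+ g. ennreal (exp (g\<^sup>2 / 8)) \<partial>centred_normal 1) \<le> 2"
proof -
  have "sqrt 8 = 2 * sqrt 2"
    using real_sqrt_mult[of 4 2] by simp
  \<comment> \<open>The tilt by \<open>exp (x\<^sup>2 / 8)\<close> lowers the precision from 1 to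
    3/4, which leaves a multiple of the normal density with standard deviation
    \<open>2 / sqrt 3\<close>.\<close>
  hence eq: "normal_density 0 1 x * exp (x\<^sup>2 / 8) = (2 / sqrt 3) * normal_density 0 (2 / sqrt 3) x" for x
    unfolding normal_density_def
    by (simp add: exp_add[symmetric] real_sqrt_mult real_sqrt_divide power_divide field_simps)
  have "(\<integral>\<^sup>+ g. ennreal (exp (g\<^sup>2 / 8)) \<partial>centred_normal 1) =
      (\<integral>\<^sup>+ g. ennreal (normal_density 0 1 g) * ennreal (exp (g\<^sup>2 / 8)) \<partial>lborel)"
    by (subst nn_integral_density) auto
  also have "\<dots> = (\<integral>\<^sup>+ x. ennreal (2 / sqrt 3) * ennreal (normal_density 0 (2 / sqrt 3) x) \<partial>lborel)"
    by (simp add: eq flip: ennreal_mult)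
  also have "\<dots> = ennreal (2 / sqrt 3)"
    by (simp add: nn_integral_cmult nn_integral_normal_density)
  also have "\<dots> \<le> ennreal 2"
    by (intro ennreal_leI) (simp add: field_simps)
  finally show ?thesis by simp
qed

lemma product_prob_space_normal:
  assumes "0 < \<sigma>"
  shows "product_prob_space (\<lambda>i. centred_normal \<sigma>)"
proof -
  interpret prob_space "centred_normal \<sigma>"
    using assms by (rule prob_space_normal_density)
  show ?thesis by unfold_locales
qed

lemma nn_integral_PiM_normal_exp:
  assumes "0 < \<sigma>" "finite I"
  shows "(\<integral>\<^sup>+ \<xi>. ennreal (exp (\<Sum>i\<in>I. a i * \<xi> i)) \<partial>(\<Pi>\<^sub>M i\<in>I. centred_normal \<sigma>)) =
    ennreal (exp (\<sigma>\<^sup>2 * (\<Sum>i\<in>I. (a i)\<^sup>2) / 2))"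
proof -
  interpret product_prob_space "\<lambda>i. centred_normal \<sigma>"
    using assms by (intro product_prob_space_normal)
  have "(\<integral>\<^sup>+ \<xi>. ennreal (exp (\<Sum>i\<in>I. a i * \<xi> i)) \<partial>(\<Pi>\<^sub>M i\<in>I. centred_normal \<sigma>)) =
      (\<integral>\<^sup>+ \<xi>. (\<Prod>i\<in>I. ennreal (exp (a i * \<xi> i))) \<partial>(\<Pi>\<^sub>M i\<in>I. centred_normal \<sigma>))"
    using assms by (simp add: exp_sum prod_ennreal)
  also have "\<dots> = (\<Prod>i\<in>I. \<integral>\<^sup>+ x. ennreal (exp (a i * x)) \<partial>centred_normal \<sigma>)"
    using assms by (intro product_nn_integral_prod) auto
  also have "\<dots> = ennreal (exp (\<sigma>\<^sup>2 * (\<Sum>i\<in>I. (a i)\<^sup>2) / 2))"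
    using assms by (simp add: nn_integral_normal_exp prod_ennreal exp_sum sum_distrib_left sum_divide_distrib)
  finally show ?thesis .
qed

text \<open>Synthesis is the adjoint of analysis, so it is a contraction as well. Concretely, the
  Cauchy-Schwarz inequality and the Bessel inequality for the synthesised \<open>h\<close> itself
  give \<open>P\<^sup>2 \<le> Q * P\<close>, and one factor \<open>P\<close> cancels.\<close>

lemma bessel_dual:
  fixes e :: "'a \<Rightarrow> 'b \<Rightarrow> real" and g :: "'a \<Rightarrow> real"
  assumes "finite \<Lambda>"
    and bessel: "\<And>f :: 'b \<Rightarrow> real. (\<Sum>\<alpha>\<in>\<Lambda>. (\<Sum>i\<in>I. e \<alpha> i * f i)\<^sup>2) \<le> (\<Sum>i\<in>I. (f i)\<^sup>2)"
    and S: "S \<subseteq> \<Lambda>"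
  shows "(\<Sum>i\<in>I. (\<Sum>\<alpha>\<in>S. g \<alpha> * e \<alpha> i)\<^sup>2) \<le> (\<Sum>\<alpha>\<in>S. (g \<alpha>)\<^sup>2)"
proof -
  define h where "h i = (\<Sum>\<alpha>\<in>S. g \<alpha> * e \<alpha> i)" for i
  define P where "P = (\<Sum>i\<in>I. (h i)\<^sup>2)"
  define Q where "Q = (\<Sum>\<alpha>\<in>S. (g \<alpha>)\<^sup>2)"
  have PQ: "0 \<le> P" "0 \<le> Q" by (auto simp: P_def Q_def intro!: sum_nonneg)
  have "P = (\<Sum>i\<in>I. \<Sum>\<alpha>\<in>S. g \<alpha> * (e \<alpha> i * h i))"
    unfolding P_def power2_eq_square
    by (subst (1) h_def) (simp add: sum_distrib_right mult.assoc)
  also have "\<dots> = (\<Sum>\<alpha>\<in>S. g \<alpha> * (\<Sum>i\<in>I. e \<alpha> i * h i))"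
    by (subst sum.swap) (simp add: sum_distrib_left)
  finally have P_eq: "P = (\<Sum>\<alpha>\<in>S. g \<alpha> * (\<Sum>i\<in>I. e \<alpha> i * h i))" .
  have "P\<^sup>2 \<le> Q * (\<Sum>\<alpha>\<in>S. (\<Sum>i\<in>I. e \<alpha> i * h i)\<^sup>2)"
    unfolding P_eq Q_def by (rule Cauchy_Schwarz_ineq_sum)
  also have "\<dots> \<le> Q * (\<Sum>\<alpha>\<in>\<Lambda>. (\<Sum>i\<in>I. e \<alpha> i * h i)\<^sup>2)"
    using assms PQ by (intro mult_left_mono sum_mono2) auto
  also have "\<dots> \<le> Q * P"
    using PQ bessel[of h] by (intro mult_left_mono) (auto simp: P_def)
  finally have "P * P \<le> Q * P" by (simp add: power2_eq_square)
  hence "P \<le> Q"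
    using PQ by (cases "P = 0") (auto simp: mult_le_cancel_right)
  thus ?thesis by (simp add: P_def Q_def h_def)
qed

text \<open>Linearising each square by \<open>exp (z\<^sup>2 / 8) = E exp (g z / 2)\<close> with an independent standard
  normal \<open>g\<close> reduces the claim to the moment generating function of \<open>\<xi>\<close>, so neither
  independence nor orthogonality of the coefficients is needed.\<close>

lemma nn_integral_exp_sum_squares_le:
  fixes e :: "'a \<Rightarrow> 'b \<Rightarrow> real"
  assumes \<sigma>: "0 < \<sigma>" and fin: "finite \<Lambda>" "finite I"
    and bessel: "\<And>f :: 'b \<Rightarrow> real. (\<Sum>\<alpha>\<in>\<Lambda>. (\<Sum>i\<in>I. e \<alpha> i * f i)\<^sup>2) \<le> (\<Sum>i\<in>I. (f i)\<^sup>2)"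
    and S: "S \<subseteq> \<Lambda>"
  shows "(\<integral>\<^sup>+ \<xi>. ennreal (exp (\<Sum>\<alpha>\<in>S. ((\<Sum>i\<in>I. e \<alpha> i * \<xi> i) / \<sigma>)\<^sup>2 / 8))
      \<partial>(\<Pi>\<^sub>M i\<in>I. centred_normal \<sigma>)) \<le> ennreal (2 ^ card S)"
proof -
  have finS: "finite S" using fin S finite_subset by blast
  interpret N: product_prob_space "\<lambda>i. centred_normal \<sigma>" I
    using \<sigma> by (intro product_prob_space_normal)
  interpret G: product_prob_space "\<lambda>i. centred_normal 1" S
    by (intro product_prob_space_normal) simp
  let ?N = "\<Pi>\<^sub>M i\<in>I. centred_normal \<sigma>" and ?G = "\<Pi>\<^sub>M \<alpha>\<in>S. centred_normal 1"
  interpret pair_sigma_finite ?N ?G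
    by unfold_locales
  let ?z = "\<lambda>\<alpha> \<xi>. (\<Sum>i\<in>I. e \<alpha> i * \<xi> i) / \<sigma>"
  let ?b = "\<lambda>g i. (\<Sum>\<alpha>\<in>S. g \<alpha> * e \<alpha> i)"
  have 1: "ennreal (exp (\<Sum>\<alpha>\<in>S. (?z \<alpha> \<xi>)\<^sup>2 / 8)) =
      (\<integral>\<^sup>+ g. ennreal (exp (\<Sum>\<alpha>\<in>S. (?z \<alpha> \<xi> / 2) * g \<alpha>)) \<partial>?G)" for \<xi>
    using finS by (subst nn_integral_PiM_normal_exp) (auto simp: power_divide simp flip: sum_divide_distrib)
  have 2: "(\<Sum>\<alpha>\<in>S. (?z \<alpha> \<xi> / 2) * g \<alpha>) = (\<Sum>i\<in>I. (?b g i / (2 * \<sigma>)) * \<xi> i)" for g \<xi>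
    by (simp add: sum_divide_distrib sum_distrib_left sum_distrib_right sum.swap[of _ S I] mult_ac)
  have "(\<integral>\<^sup>+ \<xi>. ennreal (exp (\<Sum>\<alpha>\<in>S. (?z \<alpha> \<xi>)\<^sup>2 / 8)) \<partial>?N) =
      (\<integral>\<^sup>+ \<xi>. (\<integral>\<^sup>+ g. ennreal (exp (\<Sum>\<alpha>\<in>S. (?z \<alpha> \<xi> / 2) * g \<alpha>)) \<partial>?G) \<partial>?N)"
    by (simp only: 1)
  also have "\<dots> = (\<integral>\<^sup>+ g. (\<integral>\<^sup>+ \<xi>. ennreal (exp (\<Sum>\<alpha>\<in>S. (?z \<alpha> \<xi> / 2) * g \<alpha>)) \<partial>?N) \<partial>?G)"
    by (subst Fubini') (auto)
  also have "\<dots> = (\<integral>\<^sup>+ g. (\<integral>\<^sup>+ \<xi>. ennreal (exp (\<Sum>i\<in>I. (?b g i / (2 * \<sigma>)) * \<xi> i)) \<partial>?N) \<partial>?G)"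
    by (simp only: 2)
  also have "\<dots> = (\<integral>\<^sup>+ g. ennreal (exp ((\<Sum>i\<in>I. (?b g i)\<^sup>2) / 8)) \<partial>?G)"
  proof -
    have "\<sigma>\<^sup>2 * (\<Sum>i\<in>I. (?b g i / (2 * \<sigma>))\<^sup>2) / 2 = (\<Sum>i\<in>I. (?b g i)\<^sup>2) / 8" for g
      using \<sigma> by (simp add: power_divide power_mult_distrib flip: sum_divide_distrib)
    thus ?thesis
      using \<sigma> fin by (simp only: nn_integral_PiM_normal_exp)
  qed
  \<comment> \<open>The vector synthesised from \<open>g\<close> is no longer than \<open>g\<close>;
    what remains factorises over the independent coordinates of \<open>g\<close>.\<close>
  also have "\<dots> \<le> (\<integral>\<^sup>+ g. ennreal (exp (\<Sum>\<alpha>\<in>S. (g \<alpha>)\<^sup>2 / 8)) \<partial>?G)"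
    using bessel_dual[OF fin(1) bessel S]
    by (intro nn_integral_mono ennreal_leI) (simp add: divide_right_mono flip: sum_divide_distrib)
  also have "\<dots> = (\<integral>\<^sup>+ g. (\<Prod>\<alpha>\<in>S. ennreal (exp ((g \<alpha>)\<^sup>2 / 8))) \<partial>?G)"
    using finS by (simp add: exp_sum prod_ennreal)
  also have "\<dots> = (\<Prod>\<alpha>\<in>S. \<integral>\<^sup>+ x. ennreal (exp (x\<^sup>2 / 8)) \<partial>centred_normal 1)"
    using finS by (intro G.product_nn_integral_prod) auto
  also have "\<dots> \<le> (\<Prod>\<alpha>\<in>S. 2)"
    by (intro prod_mono_ennreal nn_integral_std_normal_exp_square)
  also have "\<dots> = ennreal (2 ^ card S)"
    by (simp flip: ennreal_power)
  finally show ?thesis .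
qed

text \<open>Expanding the product over subsets \<open>S\<close> costs a factor 2 per chosen
  coefficient, by the joint bound. The sum then folds back into the product of the factors
  \<open>1 + 2 * \<kappa> \<alpha>\<close>, and \<open>1 + y \<le> exp y\<close> finishes.\<close>

lemma nn_integral_prod_one_plus_exp_square_le:
  fixes e :: "'a \<Rightarrow> 'b \<Rightarrow> real" and \<kappa> :: "'a \<Rightarrow> real"
  assumes \<sigma>: "0 < \<sigma>" and fin: "finite \<Lambda>" "finite I"
    and bessel: "\<And>f :: 'b \<Rightarrow> real. (\<Sum>\<alpha>\<in>\<Lambda>. (\<Sum>i\<in>I. e \<alpha> i * f i)\<^sup>2) \<le> (\<Sum>i\<in>I. (f i)\<^sup>2)"
    and \<kappa>: "\<And>\<alpha>. \<alpha> \<in> \<Lambda> \<Longrightarrow> 0 \<le> \<kappa> \<alpha>"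
  shows "(\<integral>\<^sup>+ \<xi>. ennreal (\<Prod>\<alpha>\<in>\<Lambda>. 1 + \<kappa> \<alpha> * exp (((\<Sum>i\<in>I. e \<alpha> i * \<xi> i) / \<sigma>)\<^sup>2 / 8))
      \<partial>(\<Pi>\<^sub>M i\<in>I. centred_normal \<sigma>)) \<le> ennreal (exp (2 * (\<Sum>\<alpha>\<in>\<Lambda>. \<kappa> \<alpha>)))"
proof -
  let ?N = "\<Pi>\<^sub>M i\<in>I. centred_normal \<sigma>"
  let ?z = "\<lambda>\<alpha> \<xi>. (\<Sum>i\<in>I. e \<alpha> i * \<xi> i) / \<sigma>"
  have nn: "0 \<le> prod \<kappa> S" if "S \<subseteq> \<Lambda>" for S
    using that \<kappa> by (intro prod_nonneg) auto
  have 1: "(\<Prod>\<alpha>\<in>\<Lambda>. 1 + \<kappa> \<alpha> * exp ((?z \<alpha> \<xi>)\<^sup>2 / 8)) =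
      (\<Sum>S\<in>Pow \<Lambda>. prod \<kappa> S * exp (\<Sum>\<alpha>\<in>S. (?z \<alpha> \<xi>)\<^sup>2 / 8))" for \<xi>
  proof -
    have "(\<Prod>\<alpha>\<in>\<Lambda>. \<kappa> \<alpha> * exp ((?z \<alpha> \<xi>)\<^sup>2 / 8) + 1) =
        (\<Sum>S\<in>Pow \<Lambda>. (\<Prod>\<alpha>\<in>S. \<kappa> \<alpha> * exp ((?z \<alpha> \<xi>)\<^sup>2 / 8)))"
      using fin by (subst prod_add) auto
    also have "\<dots> = (\<Sum>S\<in>Pow \<Lambda>. prod \<kappa> S * exp (\<Sum>\<alpha>\<in>S. (?z \<alpha> \<xi>)\<^sup>2 / 8))"
      using fin by (intro sum.cong) (auto simp: prod.distrib exp_sum dest: finite_subset)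
    finally show ?thesis by (simp add: add.commute)
  qed
  have "(\<integral>\<^sup>+ \<xi>. ennreal (\<Prod>\<alpha>\<in>\<Lambda>. 1 + \<kappa> \<alpha> * exp ((?z \<alpha> \<xi>)\<^sup>2 / 8)) \<partial>?N) =
      (\<integral>\<^sup>+ \<xi>. (\<Sum>S\<in>Pow \<Lambda>. ennreal (prod \<kappa> S) * ennreal (exp (\<Sum>\<alpha>\<in>S. (?z \<alpha> \<xi>)\<^sup>2 / 8))) \<partial>?N)"
    unfolding 1 using nn
    by (intro nn_integral_cong) (subst sum_ennreal[symmetric], auto simp: ennreal_mult)
  also have "\<dots> = (\<Sum>S\<in>Pow \<Lambda>. ennreal (prod \<kappa> S) * (\<integral>\<^sup>+ \<xi>. ennreal (exp (\<Sum>\<alpha>\<in>S. (?z \<alpha> \<xi>)\<^sup>2 / 8)) \<partial>?N))"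
    by (subst nn_integral_sum) (auto simp: nn_integral_cmult)
  also have "\<dots> \<le> (\<Sum>S\<in>Pow \<Lambda>. ennreal (prod \<kappa> S) * ennreal (2 ^ card S))"
    using nn_integral_exp_sum_squares_le[OF \<sigma> fin bessel]
    by (intro sum_mono mult_left_mono) auto
  also have "\<dots> = ennreal (\<Sum>S\<in>Pow \<Lambda>. prod \<kappa> S * 2 ^ card S)"
    using nn by (subst sum_ennreal[symmetric]) (auto simp: ennreal_mult)
  also have "(\<Sum>S\<in>Pow \<Lambda>. prod \<kappa> S * 2 ^ card S) = (\<Prod>\<alpha>\<in>\<Lambda>. \<kappa> \<alpha> * 2 + 1)"
    using fin by (subst prod_add) (auto simp: prod.distrib)
  also have "\<dots> \<le> (\<Prod>\<alpha>\<in>\<Lambda>. exp (2 * \<kappa> \<alpha>))"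
    using \<kappa> exp_ge_add_one_self
    by (intro prod_mono) (auto simp: mult.commute add.commute intro!: add_nonneg_nonneg)
  also have "\<dots> = exp (2 * (\<Sum>\<alpha>\<in>\<Lambda>. \<kappa> \<alpha>))"
    using fin by (simp add: exp_sum sum_distrib_left)
  finally show ?thesis by (simp add: ennreal_leI)
qed

section \<open>Haar coefficients and total variation\<close>

text \<open>Vectors are indexed from 1, so \<open>i - 1\<close> is the zero-based position.
  Intersecting with \<open>{1..n}\<close> admits every length: the last block may be cut short, and
  later ones are empty.\<close>

definition dyadic_block :: "nat \<Rightarrow> nat \<Rightarrow> nat \<Rightarrow> nat set" where
  "dyadic_block n r k = {i \<in> {1..n}. (i - 1) div 2 ^ r = k}"

text \<open>A Haar coefficient before normalisation; \<open>k\<close> numbers the parent block, of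
  level \<open>Suc r\<close>.\<close>

definition haar_diff :: "nat \<Rightarrow> nat \<Rightarrow> nat \<Rightarrow> (nat \<Rightarrow> real) \<Rightarrow> real" where
  "haar_diff n r k f = sum f (dyadic_block n r (2 * k)) - sum f (dyadic_block n r (2 * k + 1))"

lemma finite_dyadic_block [simp]: "finite (dyadic_block n r k)"
  by (simp add: dyadic_block_def)

lemma dyadic_block_disjoint: "k \<noteq> l \<Longrightarrow> dyadic_block n r k \<inter> dyadic_block n r l = {}"
  by (auto simp: dyadic_block_def)

lemma dyadic_block_Suc:
  "dyadic_block n (Suc r) k = dyadic_block n r (2 * k) \<union> dyadic_block n r (2 * k + 1)"
proof -
  have "(i - 1) div 2 ^ Suc r = ((i - 1) div 2 ^ r) div 2" for i :: nat
    by (simp only: power_Suc2 div_mult2_eq)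
  moreover have "q div 2 = k \<longleftrightarrow> q = 2 * k \<or> q = 2 * k + 1" for q :: nat
    by presburger
  ultimately show ?thesis
    by (auto simp: dyadic_block_def)
qed

lemma sum_dyadic_block_Suc:
  "sum f (dyadic_block n (Suc r) k) = sum f (dyadic_block n r (2 * k)) + sum f (dyadic_block n r (2 * k + 1))"
  unfolding dyadic_block_Suc by (intro sum.union_disjoint dyadic_block_disjoint) auto

lemma dyadic_block_full:
  assumes "(k + 1) * 2 ^ r \<le> n"
  shows "dyadic_block n r k = {k * 2 ^ r + 1..(k + 1) * 2 ^ r}"
proof -
  have *: "(i - 1) div 2 ^ r = k \<longleftrightarrow> k * 2 ^ r + 1 \<le> i \<and> i \<le> (k + 1) * 2 ^ r" if "1 \<le> i" for i :: nat
  proof -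
    have "(i - 1) div 2 ^ r = k \<longleftrightarrow> k \<le> (i - 1) div 2 ^ r \<and> (i - 1) div 2 ^ r < k + 1"
      by auto
    also have "\<dots> \<longleftrightarrow> k * 2 ^ r \<le> i - 1 \<and> i - 1 < (k + 1) * 2 ^ r"
      by (simp only: less_eq_div_iff_mult_less_eq div_less_iff_less_mult zero_less_power zero_less_numeral)
    also have "k * 2 ^ r \<le> i - 1 \<longleftrightarrow> k * 2 ^ r + 1 \<le> i"
      using that by linarith
    also have "i - 1 < (k + 1) * 2 ^ r \<longleftrightarrow> i \<le> (k + 1) * 2 ^ r"
      using that by linarith
    finally show ?thesis .
  qed
  have "i \<in> dyadic_block n r k \<longleftrightarrow> i \<in> {k * 2 ^ r + 1..(k + 1) * 2 ^ r}" for i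
  proof (cases "1 \<le> i")
    case True
    show ?thesis
      unfolding dyadic_block_def mem_Collect_eq *[OF True] using assms True by auto
  qed (auto simp: dyadic_block_def)
  thus ?thesis by blast
qed

lemma sum_lessThan_double:
  fixes h :: "nat \<Rightarrow> real"
  shows "(\<Sum>k<2 * M. h k) = (\<Sum>k<M. h (2 * k) + h (2 * k + 1))"
  by (induction M) auto

text \<open>The identity \<open>a * a' + b * b' = ((a + b) * (a' + b') + (a - b) * (a' - b')) /
  2\<close> for sibling block sums replaces level \<open>r\<close> by level \<open>Suc r\<close>
  plus a wavelet contribution. Telescoping from single entries up to the whole vector collects all
  levels.\<close>

lemma haar_parseval:
  assumes "n \<le> 2 ^ L"
  shows "(\<Sum>i=1..n. f i * g i) =
    (\<Sum>r\<le>L. (\<Sum>k<2 ^ (L - Suc r). haar_diff n r k f * haar_diff n r k g) / 2 ^ min (Suc r) L)"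
proof -
  define T where "T r = (\<Sum>k<2 ^ (L - r). sum f (dyadic_block n r k) * sum g (dyadic_block n r k)) / 2 ^ r" for r
  define D where "D r = (\<Sum>k<2 ^ (L - Suc r). haar_diff n r k f * haar_diff n r k g) / 2 ^ Suc r" for r
  have step: "T r = T (Suc r) + D r" if "r < L" for r
  proof -
    have "(2::nat) ^ (L - r) = 2 * 2 ^ (L - Suc r)"
      using that by (metis Suc_diff_Suc power_Suc)
    hence "T r = (\<Sum>k<2 ^ (L - Suc r).
        sum f (dyadic_block n r (2*k)) * sum g (dyadic_block n r (2*k)) +
        sum f (dyadic_block n r (2*k+1)) * sum g (dyadic_block n r (2*k+1))) / 2 ^ r"
      by (simp only: T_def sum_lessThan_double)
    also have "\<dots> = (\<Sum>k<2 ^ (L - Suc r).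
        sum f (dyadic_block n (Suc r) k) * sum g (dyadic_block n (Suc r) k)
        + haar_diff n r k f * haar_diff n r k g) / 2 ^ Suc r"
      unfolding sum_divide_distrib haar_diff_def sum_dyadic_block_Suc
      by (intro sum.cong) (auto simp: field_simps)
    also have "\<dots> = T (Suc r) + D r"
      by (simp add: T_def D_def sum.distrib add_divide_distrib)
    finally show ?thesis .
  qed
  have "T 0 = T r + (\<Sum>q<r. D q)" if "r \<le> L" for r
    using that by (induction r) (auto simp: step)
  hence "T 0 = T L + (\<Sum>q<L. D q)" by simp
  \<comment> \<open>The sibling of the top block is empty, so the Haar difference of level
    \<open>L\<close> is the full sum. Truncated subtraction leaves only \<open>k = 0\<close> at that
    level.\<close>
  moreover have "T L = haar_diff n L 0 f * haar_diff n L 0 g / 2 ^ L"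
  proof -
    have "i - Suc 0 < 2 ^ L" if "i \<le> n" "1 \<le> i" for i
      using that assms by linarith
    hence "dyadic_block n L 1 = {}"
      by (auto simp: dyadic_block_def)
    thus ?thesis by (simp add: T_def haar_diff_def)
  qed
  moreover have "T 0 = (\<Sum>i=1..n. f i * g i)"
  proof -
    have b: "dyadic_block n 0 k = (if k < n then {Suc k} else {})" for k
      by (auto simp: dyadic_block_def)
    have "T 0 = (\<Sum>k<2 ^ L. if k < n then f (Suc k) * g (Suc k) else 0)"
      unfolding T_def b by (auto intro!: sum.cong)
    also have "\<dots> = (\<Sum>k<n. f (Suc k) * g (Suc k))"
      using assms by (subst sum.inter_filter[symmetric]) (auto intro!: sum.cong)
    also have "\<dots> = (\<Sum>i=1..n. f i * g i)"
      by (simp add: sum.atLeast1_atMost_eq)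
    finally show ?thesis .
  qed
  moreover have "(\<Sum>r\<le>L. (\<Sum>k<2 ^ (L - Suc r). haar_diff n r k f * haar_diff n r k g) / 2 ^ min (Suc r) L) =
      (\<Sum>q<L. D q) + haar_diff n L 0 f * haar_diff n L 0 g / 2 ^ L"
  proof -
    have "(\<Sum>r<L. (\<Sum>k<2 ^ (L - Suc r). haar_diff n r k f * haar_diff n r k g) / 2 ^ min (Suc r) L) = (\<Sum>q<L. D q)"
      unfolding D_def by (intro sum.cong refl) (simp add: min_def)
    thus ?thesis
      by (simp add: lessThan_Suc_atMost[symmetric])
  qed
  ultimately show ?thesis by simp
qed

lemma haar_diff_cong:
  "(\<And>i. i \<in> dyadic_block n (Suc r) k \<Longrightarrow> f i = g i) \<Longrightarrow> haar_diff n r k f = haar_diff n r k g"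
  unfolding haar_diff_def dyadic_block_Suc by (intro arg_cong2[where f = minus] sum.cong) auto

section \<open>Haar coefficients bounded by total variation\<close>

definition total_var :: "nat \<Rightarrow> (nat \<Rightarrow> real) \<Rightarrow> real" where
  "total_var n f = (\<Sum>j\<in>{1..<n}. \<bar>f (j + 1) - f j\<bar>)"

lemma abs_diff_le_sum_increments:
  fixes f :: "nat \<Rightarrow> real"
  assumes "a \<le> b"
  shows "\<bar>f a - f b\<bar> \<le> (\<Sum>j\<in>{a..<b}. \<bar>f (j + 1) - f j\<bar>)"
proof -
  have "f b - f a = (\<Sum>j\<in>{a..<b}. f (j + 1) - f j)"
    using assms by (simp add: sum_Suc_diff')
  thus ?thesis
    using sum_abs[of "\<lambda>j. f (j + 1) - f j" "{a..<b}"] by (simp add: abs_minus_commute)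
qed

text \<open>Entry \<open>i\<close> of the left half is paired with \<open>i + 2 ^ r\<close> in the
  right half, and the path between them stays inside the parent block. The open interval omits the
  increments that cross into neighbouring blocks, so the sums for different \<open>k\<close> do not
  overlap.\<close>

lemma abs_haar_diff_le:
  assumes "(k + 1) * 2 ^ Suc r \<le> n"
  shows "\<bar>haar_diff n r k f\<bar> \<le>
    2 ^ r * (\<Sum>j\<in>{k * 2 ^ Suc r<..<(k + 1) * 2 ^ Suc r}. \<bar>f (j + 1) - f j\<bar>)" (is "_ \<le> _ * ?S")
proof -
  let ?a = "2 * k * 2 ^ r"
  have le: "(2 * k + 1 + 1) * 2 ^ r \<le> n" "(2 * k + 1) * 2 ^ r \<le> n"
    using assms by (auto simp: algebra_simps)
  have "haar_diff n r k f = sum f {?a + 1..?a + 2 ^ r} - sum f {?a + 1 + 2 ^ r..?a + 2 ^ r + 2 ^ r}"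
    using dyadic_block_full[OF le(1)] dyadic_block_full[OF le(2)]
    by (simp add: haar_diff_def algebra_simps)
  also have "sum f {?a + 1 + 2 ^ r..?a + 2 ^ r + 2 ^ r} = (\<Sum>i\<in>{?a + 1..?a + 2 ^ r}. f (i + 2 ^ r))"
    by (rule sum.shift_bounds_cl_nat_ivl)
  finally have "haar_diff n r k f = (\<Sum>i\<in>{?a + 1..?a + 2 ^ r}. f i - f (i + 2 ^ r))"
    by (simp add: sum_subtractf)
  hence "\<bar>haar_diff n r k f\<bar> \<le> (\<Sum>i\<in>{?a + 1..?a + 2 ^ r}. \<bar>f i - f (i + 2 ^ r)\<bar>)"
    by (simp add: sum_abs)
  also have "\<dots> \<le> (\<Sum>i\<in>{?a + 1..?a + 2 ^ r}. ?S)"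
  proof (intro sum_mono)
    fix i assume i: "i \<in> {?a + 1..?a + 2 ^ r}"
    have "\<bar>f i - f (i + 2 ^ r)\<bar> \<le> (\<Sum>j\<in>{i..<i + 2 ^ r}. \<bar>f (j + 1) - f j\<bar>)"
      by (rule abs_diff_le_sum_increments) simp
    also have "\<dots> \<le> ?S"
      using i by (intro sum_mono2) (auto simp: algebra_simps)
    finally show "\<bar>f i - f (i + 2 ^ r)\<bar> \<le> ?S" .
  qed
  also have "\<dots> = 2 ^ r * ?S" by simp
  finally show ?thesis .
qed

lemma sum_abs_haar_diff_le:
  assumes "finite K" and K: "\<And>k. k \<in> K \<Longrightarrow> (k + 1) * 2 ^ Suc r \<le> n"
  shows "(\<Sum>k\<in>K. \<bar>haar_diff n r k f\<bar>) \<le> 2 ^ r * total_var n f"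
proof -
  let ?l = "(2::nat) ^ Suc r"
  let ?J = "\<lambda>k. {k * ?l<..<(k + 1) * ?l}"
  have disj: "?J k \<inter> ?J k' = {}" if "k \<noteq> k'" for k k'
  proof -
    have *: "(a + 1) * ?l \<le> b * ?l" if "a < b" for a b
      using that by (intro mult_right_mono) auto
    consider "k < k'" | "k' < k" using \<open>k \<noteq> k'\<close> by linarith
    thus ?thesis
    proof cases
      case 1 show ?thesis using *[OF 1] by (auto simp del: power_Suc)
    next
      case 2 show ?thesis using *[OF 2] by (auto simp del: power_Suc)
    qed
  qed
  have "(\<Sum>k\<in>K. \<bar>haar_diff n r k f\<bar>) \<le> (\<Sum>k\<in>K. 2 ^ r * (\<Sum>j\<in>?J k. \<bar>f (j + 1) - f j\<bar>))"
    using K by (intro sum_mono abs_haar_diff_le)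
  also have "\<dots> = 2 ^ r * (\<Sum>j\<in>(\<Union>k\<in>K. ?J k). \<bar>f (j + 1) - f j\<bar>)"
    using assms(1) disj by (subst sum.UNION_disjoint) (auto simp: sum_distrib_left)
  also have "\<dots> \<le> 2 ^ r * total_var n f"
    unfolding total_var_def
  proof (intro mult_left_mono sum_mono2)
    show "(\<Union>k\<in>K. ?J k) \<subseteq> {1..<n}"
      using K by (fastforce simp del: power_Suc)
  qed auto
  finally show ?thesis .
qed

lemma total_var_diff_le: "total_var n (\<lambda>i. f i - g i) \<le> total_var n f + total_var n g"
  unfolding total_var_def sum.distrib[symmetric] by (intro sum_mono) linarith

lemma total_var_unimodal_le:
  fixes f :: "nat \<Rightarrow> real"
  assumes m: "1 \<le> m" "m \<le> n"
    and dec: "\<And>i. i \<in> {1..<m} \<Longrightarrow> f (i + 1) \<le> f i" and inc: "\<And>i. i \<in> {m..<n} \<Longrightarrow> f i \<le> f (i + 1)"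
    and range: "\<And>i. i \<in> {1..n} \<Longrightarrow> a \<le> f i \<and> f i \<le> b"
  shows "total_var n f \<le> 2 * (b - a)"
proof -
  have "total_var n f = (\<Sum>j\<in>{1..<m}. \<bar>f (j + 1) - f j\<bar>) + (\<Sum>j\<in>{m..<n}. \<bar>f (j + 1) - f j\<bar>)"
    unfolding total_var_def using m by (simp add: sum.atLeastLessThan_concat)
  also have "(\<Sum>j\<in>{1..<m}. \<bar>f (j + 1) - f j\<bar>) = (\<Sum>j\<in>{1..<m}. - (f (j + 1) - f j))"
    using dec by (intro sum.cong) (simp_all add: abs_of_nonpos)
  also have "\<dots> = f 1 - f m"
    unfolding sum_negf using m by (simp add: sum_Suc_diff')
  also have "(\<Sum>j\<in>{m..<n}. \<bar>f (j + 1) - f j\<bar>) = (\<Sum>j\<in>{m..<n}. f (j + 1) - f j)"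
    using inc by (intro sum.cong) auto
  also have "\<dots> = f n - f m"
    using m by (simp add: sum_Suc_diff')
  finally show ?thesis
    using range[of 1] range[of m] range[of n] m by simp
qed

section \<open>Range of a unimodal sequence away from its end points and mode\<close>

lemma unimodal_at_antimono:
  assumes "f \<in> unimodal_at n m" "1 \<le> i" "i \<le> j" "j \<le> m"
  shows "f j \<le> f i"
  using assms(3,4)
proof (induction j rule: dec_induct)
  case (step q)
  thus ?case using assms by (auto simp: unimodal_at_def intro: order_trans)
qed simp

lemma unimodal_at_mono:
  assumes "f \<in> unimodal_at n m" "m \<le> i" "i \<le> j" "j \<le> n"
  shows "f i \<le> f j"
  using assms(3,4)
proof (induction j rule: dec_induct)
  case (step q)
  thus ?case using assms by (auto simp: unimodal_at_def intro: order_trans)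
qed simp

text \<open>Meant for a run \<open>J\<close> of indices on which one sequence leaves the range of
  another by at least \<open>c\<close>: the squared distance is then at least
  \<open>card J * c\<^sup>2\<close>.\<close>

lemma lower_bound_le_L2_average:
  fixes w :: "'a \<Rightarrow> real"
  assumes "finite I" "J \<subseteq> I" "0 < card J" "\<And>j. j \<in> J \<Longrightarrow> c \<le> w j"
  shows "c \<le> sqrt (\<Sum>i\<in>I. (w i)\<^sup>2) / sqrt (card J)"
proof (cases "0 \<le> c")
  case True
  have "card J * c\<^sup>2 = (\<Sum>j\<in>J. c\<^sup>2)" by simp
  also have "\<dots> \<le> (\<Sum>j\<in>J. (w j)\<^sup>2)"
    using assms True by (intro sum_mono power_mono) auto
  also have "\<dots> \<le> (\<Sum>i\<in>I. (w i)\<^sup>2)"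
    using assms by (intro sum_mono2) auto
  finally have "sqrt (card J * c\<^sup>2) \<le> sqrt (\<Sum>i\<in>I. (w i)\<^sup>2)"
    by (rule real_sqrt_le_mono)
  thus ?thesis
    using True assms by (simp add: real_sqrt_mult field_simps)
next
  case False
  have "0 \<le> sqrt (\<Sum>i\<in>I. (w i)\<^sup>2) / sqrt (card J)"
    by (simp add: sum_nonneg)
  thus ?thesis using False by linarith
qed

text \<open>The \<open>k\<close>-th block of length \<open>\<ell>\<close> keeps a distance of at least \<open>\<ell>\<close> from the points \<open>1\<close>, \<open>m\<close>,
  \<open>n\<close>, where a unimodal sequence close to \<open>u\<close> may leave the range of \<open>u\<close>. Blocks outside
  \<open>{1..n}\<close> also count.\<close>

definition regular :: "nat \<Rightarrow> nat \<Rightarrow> nat \<Rightarrow> nat \<Rightarrow> bool" where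
  "regular n m l k \<longleftrightarrow> n \<le> k * l \<or> (1 \<le> k \<and> (k + 2) * l \<le> m) \<or> (m + l \<le> k * l \<and> (k + 2) * l \<le> n)"

text \<open>An irregular index is \<open>0\<close>, lies within one of \<open>m div l\<close>, or is
  \<open>n div l - 1\<close> or \<open>n div l\<close>. The count is free of \<open>l\<close>, so
  over all levels only a logarithmic number of coefficients inside the sample go without
  control.\<close>

lemma card_irregular_le:
  assumes "0 < l"
  shows "finite {k. \<not> regular n m l k}" "card {k. \<not> regular n m l k} \<le> 6"
proof -
  have sub: "{k. \<not> regular n m l k} \<subseteq> {0, m div l - 1, m div l, m div l + 1, n div l - 1, n div l}"
  proof
    fix k assume "k \<in> {k. \<not> regular n m l k}"
    hence k: "k * l < n" "k = 0 \<or> m < (k + 2) * l" "k * l < m + l \<or> n < (k + 2) * l"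
      by (auto simp: regular_def)
    have 1: "k \<le> n div l"
      using k(1) assms by (simp add: less_eq_div_iff_mult_less_eq)
    have 2: "n div l < k + 2" if "n < (k + 2) * l"
      using that assms by (simp add: div_less_iff_less_mult)
    have 3: "m div l < k + 2" if "m < (k + 2) * l"
      using that assms by (simp add: div_less_iff_less_mult)
    have 4: "k \<le> m div l + 1" if "k * l < m + l"
    proof -
      have "k \<le> (m + l) div l"
        using that assms by (subst less_eq_div_iff_mult_less_eq) auto
      thus ?thesis using assms by simp
    qed
    show "k \<in> {0, m div l - 1, m div l, m div l + 1, n div l - 1, n div l}"
      using k(2,3) 1 2 3 4 by fastforce
  qed
  thus "finite {k. \<not> regular n m l k}"
    by (rule finite_subset) simp
  have "card {0, m div l - 1, m div l, m div l + 1, n div l - 1, n div l} \<le> 6"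
    by (rule order_trans[OF card_length[of "[_,_,_,_,_,_]", simplified]]) simp
  with sub show "card {k. \<not> regular n m l k} \<le> 6"
    by (meson card_mono finite.emptyI finite.insertI order_trans)
qed

text \<open>On the monotone branch of \<open>v\<close> that contains \<open>i\<close> there are
  \<open>l\<close> indices to the left of \<open>i\<close> and \<open>l\<close> to the right. On one
  run \<open>v\<close> is at least \<open>v i\<close>, on the other at most \<open>v i\<close>. An
  overshoot of \<open>v i\<close> beyond \<open>a\<close> or \<open>b\<close> is thus shared by
  \<open>l\<close> entries of \<open>v - u\<close>.\<close>

lemma regular_block_range:
  fixes u v :: "nat \<Rightarrow> real" and n :: nat
  defines "T \<equiv> sqrt (\<Sum>i=1..n. (v i - u i)\<^sup>2)"
  assumes v: "v \<in> unimodal_at n m" and m: "1 \<le> m" "m \<le> n"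
    and u: "\<And>i. i \<in> {1..n} \<Longrightarrow> a \<le> u i \<and> u i \<le> b"
    and l: "0 < l" and reg: "regular n m l k" and kn: "k * l < n"
    and i: "k * l < i" "i \<le> (k + 1) * l"
  shows "a - T / sqrt l \<le> v i" "v i \<le> b + T / sqrt l"
proof -
  have up: "v i \<le> b + T / sqrt l" if "J \<subseteq> {1..n}" "card J = l" "\<And>j. j \<in> J \<Longrightarrow> v i \<le> v j" for J
  proof -
    have "v i - b \<le> sqrt (\<Sum>i=1..n. (v i - u i)\<^sup>2) / sqrt (card J)"
    proof (rule lower_bound_le_L2_average)
      fix j assume "j \<in> J"
      thus "v i - b \<le> v j - u j" using that u[of j] by (intro diff_mono) auto
    qed (use that l in auto)
    thus ?thesis using that by (simp add: T_def)
  qed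
  have low: "a - T / sqrt l \<le> v i" if "J \<subseteq> {1..n}" "card J = l" "\<And>j. j \<in> J \<Longrightarrow> v j \<le> v i" for J
  proof -
    have "a - v i \<le> sqrt (\<Sum>i=1..n. (u i - v i)\<^sup>2) / sqrt (card J)"
    proof (rule lower_bound_le_L2_average)
      fix j assume "j \<in> J"
      thus "a - v i \<le> u j - v j" using that u[of j] by (intro diff_mono) auto
    qed (use that l in auto)
    thus ?thesis using that by (simp add: T_def power2_commute)
  qed
  have il: "i + l \<le> (k + 2) * l" using i by (simp add: algebra_simps)
  consider "1 \<le> k" "(k + 2) * l \<le> m" | "m + l \<le> k * l" "(k + 2) * l \<le> n"
    using reg kn by (auto simp: regular_def)
  hence "a - T / sqrt l \<le> v i \<and> v i \<le> b + T / sqrt l"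
  proof cases
    \<comment> \<open>Left of the mode: \<open>{1..l}\<close> precedes \<open>i\<close> because
      \<open>1 \<le> k\<close>, and the \<open>l\<close> indices after \<open>i\<close> end by
      \<open>m\<close>.\<close>
    case 1
    have "1 * l \<le> k * l" using 1 by (intro mult_right_mono) auto
    hence "l < i" using i(1) by linarith
    hence "v i \<le> b + T / sqrt l"
      using 1 il m by (intro up[of "{1..l}"] unimodal_at_antimono[OF v]) auto
    moreover have "a - T / sqrt l \<le> v i"
      using 1 il m \<open>l < i\<close> by (intro low[of "{i+1..i+l}"] unimodal_at_antimono[OF v]) auto
    ultimately show ?thesis by simp
  next
    case 2
    have "m + l < i" using 2 i by simp
    hence "a - T / sqrt l \<le> v i"
      using 2 il m by (intro low[of "{i-l..<i}"] unimodal_at_mono[OF v]) auto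
    moreover have "v i \<le> b + T / sqrt l"
      using 2 il m \<open>m + l < i\<close> by (intro up[of "{i+1..i+l}"] unimodal_at_mono[OF v]) auto
    ultimately show ?thesis by simp
  qed
  thus "a - T / sqrt l \<le> v i" "v i \<le> b + T / sqrt l" by auto
qed

lemma haar_diff_outside:
  assumes "n \<le> k * 2 ^ Suc r"
  shows "haar_diff n r k f = 0"
proof -
  have "dyadic_block n (Suc r) k = {}"
  proof -
    have "(i - 1) div 2 ^ Suc r < k" if "i \<in> {1..n}" for i
    proof -
      have "i - 1 < k * 2 ^ Suc r" using that assms by auto
      thus ?thesis by (simp only: div_less_iff_less_mult zero_less_power zero_less_numeral)
    qed
    thus ?thesis by (fastforce simp: dyadic_block_def)
  qed
  thus ?thesis by (simp add: haar_diff_def dyadic_block_Suc)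
qed

lemma variation_bounds:
  fixes u :: "nat \<Rightarrow> real"
  assumes "i \<in> {1..n}"
  shows "Min (u ` {1..n}) \<le> u i \<and> u i \<le> Max (u ` {1..n})"
  using assms by simp

text \<open>On regular blocks \<open>v\<close> agrees with its truncation to a slight enlargement of the range of
  \<open>u\<close>, which is again unimodal and therefore has small total variation.\<close>

lemma sum_abs_haar_diff_regular_le:
  fixes u v :: "nat \<Rightarrow> real" and n :: nat
  defines "T \<equiv> sqrt (\<Sum>i=1..n. (v i - u i)\<^sup>2)"
  assumes u: "u \<in> unimodal n" and v: "v \<in> unimodal_at n m" and m: "1 \<le> m" "m \<le> n"
  shows "(\<Sum>k | k < M \<and> regular n m (2 ^ Suc r) k. \<bar>haar_diff n r k (\<lambda>i. v i - u i)\<bar>) \<le>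
    2 ^ r * (4 * variation n u + 4 * T / sqrt (2 ^ Suc r))"
proof -
  define l :: nat where "l = 2 ^ Suc r"
  define a where "a = Min (u ` {1..n})"
  define b where "b = Max (u ` {1..n})"
  define t where "t = T / sqrt l"
  define v' where "v' i = max (a - t) (min (b + t) (v i))" for i
  have ub: "a \<le> u i \<and> u i \<le> b" if "i \<in> {1..n}" for i
    using variation_bounds[OF that, of u] by (simp add: a_def b_def)
  have t: "0 \<le> t" by (simp add: t_def T_def sum_nonneg)
  have ab: "a \<le> b" using ub[of 1] m by auto
  have Vab: "variation n u = b - a" by (simp add: variation_def a_def b_def)
  have tv_u: "total_var n u \<le> 2 * (b - a)"
  proof -
    obtain p where "1 \<le> p" "p \<le> n" "u \<in> unimodal_at n p"
      using u by (auto simp: unimodal_def)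
    thus ?thesis
      using ub by (intro total_var_unimodal_le[of p]) (auto simp: unimodal_at_def)
  qed
  have v'_mono: "v' i \<le> v' j" if "v i \<le> v j" for i j
    using that by (auto simp: v'_def)
  have tv_v': "total_var n v' \<le> 2 * ((b + t) - (a - t))"
  proof (rule total_var_unimodal_le[OF m])
    show "a - t \<le> v' i \<and> v' i \<le> b + t" for i
      using ab t by (auto simp: v'_def)
  qed (use v in \<open>auto simp: unimodal_at_def intro!: v'_mono\<close>)
  let ?K = "{k. k < M \<and> regular n m (2 ^ Suc r) k}"
  let ?K' = "{k. k < M \<and> regular n m (2 ^ Suc r) k \<and> k * 2 ^ Suc r < n}"
  \<comment> \<open>Blocks with \<open>n \<le> k * 2 ^ Suc r\<close> are empty and contribute
    nothing. The remaining regular blocks are complete, since another block length fits before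
    \<open>m\<close> or \<open>n\<close>.\<close>
  have "(\<Sum>k\<in>?K. \<bar>haar_diff n r k (\<lambda>i. v i - u i)\<bar>) = (\<Sum>k\<in>?K'. \<bar>haar_diff n r k (\<lambda>i. v i - u i)\<bar>)"
    by (intro sum.mono_neutral_right) (auto intro!: haar_diff_outside simp: not_less simp del: power_Suc)
  also have "\<dots> = (\<Sum>k\<in>?K'. \<bar>haar_diff n r k (\<lambda>i. v' i - u i)\<bar>)"
  proof (intro sum.cong refl arg_cong[where f = abs] haar_diff_cong)
    fix k i assume k: "k \<in> ?K'" and i: "i \<in> dyadic_block n (Suc r) k"
    have kl: "regular n m l k" "k * l < n" using k by (auto simp: l_def)
    have "(k + 1) * l \<le> n"
      using kl m by (auto simp: regular_def algebra_simps)
    hence "k * l < i" "i \<le> (k + 1) * l"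
      using i dyadic_block_full[of k "Suc r" n] by (auto simp: l_def)
    hence "a - t \<le> v i" "v i \<le> b + t"
      using regular_block_range[OF v m ub _ kl, where i = i] unfolding t_def T_def by (auto simp: l_def)
    thus "v i - u i = v' i - u i" by (simp add: v'_def)
  qed
  also have "\<dots> \<le> 2 ^ r * total_var n (\<lambda>i. v' i - u i)"
  proof (rule sum_abs_haar_diff_le)
    fix k assume "k \<in> ?K'"
    hence "regular n m l k" "k * l < n" by (auto simp: l_def)
    hence "(k + 1) * l \<le> n" using m by (auto simp: regular_def algebra_simps)
    thus "(k + 1) * 2 ^ Suc r \<le> n" by (simp add: l_def)
  qed simp
  also have "\<dots> \<le> 2 ^ r * (2 * ((b + t) - (a - t)) + 2 * (b - a))"
    using total_var_diff_le[of n v' u] tv_u tv_v' by (intro mult_left_mono) auto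
  also have "\<dots> = 2 ^ r * (4 * variation n u + 4 * T / sqrt (2 ^ Suc r))"
    by (simp add: Vab t_def l_def algebra_simps)
  finally show ?thesis .
qed

section \<open>The normalised Haar system and its level-dependent thresholds\<close>

definition haar_index :: "nat \<Rightarrow> (nat \<times> nat) set" where
  "haar_index L = (SIGMA r:{..L}. {..<2 ^ (L - Suc r)})"

text \<open>The minimum in the normalisation turns the wavelet of level \<open>L\<close>, whose right half is empty,
  into the constant scaling function.\<close>

definition haar_vec :: "nat \<Rightarrow> nat \<Rightarrow> nat \<times> nat \<Rightarrow> nat \<Rightarrow> real" where
  "haar_vec n L = (\<lambda>(r, k) i.
     (of_bool (i \<in> dyadic_block n r (2 * k)) - of_bool (i \<in> dyadic_block n r (2 * k + 1)))
       / sqrt (2 ^ min (Suc r) L))"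

lemma finite_haar_index [simp]: "finite (haar_index L)"
  by (simp add: haar_index_def)

lemma sum_haar_index: "(\<Sum>\<alpha>\<in>haar_index L. F \<alpha>) = (\<Sum>r\<le>L. \<Sum>k<2 ^ (L - Suc r). F (r, k))"
  unfolding haar_index_def by (subst sum.Sigma) (auto simp: case_prod_beta)

lemma haar_vec_coeff:
  "(\<Sum>i=1..n. haar_vec n L (r, k) i * f i) = haar_diff n r k f / sqrt (2 ^ min (Suc r) L)"
proof -
  have sub: "dyadic_block n r k \<subseteq> {1..n}" for k by (auto simp: dyadic_block_def)
  have "(\<Sum>i=1..n. of_bool (i \<in> dyadic_block n r k) * f i) = sum f (dyadic_block n r k)" for k
    using sub[of k] by (simp add: of_bool_def if_distrib sum.If_cases Int_absorb1 if_distribR cong: if_cong)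
  thus ?thesis
    by (simp add: haar_vec_def haar_diff_def left_diff_distrib sum_subtractf flip: sum_divide_distrib)
qed

lemma haar_vec_parseval:
  assumes "n \<le> 2 ^ L"
  shows "(\<Sum>i=1..n. f i * g i) = (\<Sum>\<alpha>\<in>haar_index L.
    (\<Sum>i=1..n. haar_vec n L \<alpha> i * f i) * (\<Sum>i=1..n. haar_vec n L \<alpha> i * g i))"
  by (simp add: haar_parseval[OF assms, of f g] sum_haar_index haar_vec_coeff sum_divide_distrib
      del: One_nat_def power_Suc)

text \<open>Irregular blocks get no threshold because their absolute sum is not controlled. The
  subtraction truncates, so only levels below \<open>\<rho>\<close> are thresholded, the finest ones
  most. The factor 4 yields \<open>exp (- s\<^sup>2 / 8) \<le> (1 / 4) ^ (\<rho> - r)\<close>, which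
  outweighs the doubling of the number of wavelets per finer level.\<close>

definition haar_threshold :: "nat \<Rightarrow> nat \<Rightarrow> nat \<Rightarrow> nat \<times> nat \<Rightarrow> real" where
  "haar_threshold n \<rho> m = (\<lambda>(r, k). if regular n m (2 ^ Suc r) k then 4 * real (\<rho> - r) else 0)"

lemma sum_geometric_sqrt2: "(\<Sum>r<\<rho>. sqrt 2 ^ r) \<le> 3 * sqrt 2 ^ \<rho>"
proof (induction \<rho>)
  case (Suc \<rho>)
  have "(4::real) / 3 \<le> sqrt 2" by (rule real_le_rsqrt) (simp add: power2_eq_square)
  hence "4 * sqrt 2 ^ \<rho> \<le> 3 * sqrt 2 * sqrt 2 ^ \<rho>"
    by (intro mult_right_mono) auto
  with Suc have "(\<Sum>r<\<rho>. sqrt 2 ^ r) + sqrt 2 ^ \<rho> \<le> 3 * sqrt 2 * sqrt 2 ^ \<rho>"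
    by linarith
  thus ?case by (simp add: mult.assoc)
qed simp

text \<open>The \<open>- 1\<close> lets the bound vanish at \<open>\<rho> = 0\<close>. This matters
  for large variation, where \<open>\<rho> = 0\<close> and a leftover term of order \<open>V\<close>
  would be too big.\<close>

lemma sum_linear_geometric_sqrt2: "(\<Sum>r<\<rho>. real (\<rho> - r) * sqrt 2 ^ r) \<le> 20 * (sqrt 2 ^ \<rho> - 1)"
proof (induction \<rho>)
  case (Suc \<rho>)
  have "(4::real) / 3 \<le> sqrt 2" by (rule real_le_rsqrt) (simp add: power2_eq_square)
  \<comment> \<open>Here \<open>17 = 20 - 3\<close>: what remains of the new bound after paying for
    the geometric sum.\<close>
  hence *: "20 * sqrt 2 ^ \<rho> \<le> (17 * sqrt 2) * sqrt 2 ^ \<rho>"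
    by (intro mult_right_mono) auto
  have "(\<Sum>r<Suc \<rho>. real (Suc \<rho> - r) * sqrt 2 ^ r) =
      (\<Sum>r<Suc \<rho>. real (\<rho> - r) * sqrt 2 ^ r + sqrt 2 ^ r)"
    by (intro sum.cong) (auto simp: Suc_diff_le algebra_simps)
  also have "\<dots> = (\<Sum>r<\<rho>. real (\<rho> - r) * sqrt 2 ^ r) + (\<Sum>r<Suc \<rho>. sqrt 2 ^ r)"
    by (simp add: sum.distrib)
  also have "\<dots> \<le> 20 * (sqrt 2 ^ \<rho> - 1) + 3 * sqrt 2 ^ Suc \<rho>"
    using Suc sum_geometric_sqrt2[of "Suc \<rho>"] by (intro add_mono)
  also have "\<dots> \<le> 20 * (sqrt 2 ^ Suc \<rho> - 1)"
    using * by (simp add: algebra_simps del: mult_le_cancel_right mult_le_cancel_left)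
  finally show ?case .
qed simp

text \<open>At a level \<open>r < \<rho>\<close>, threshold, normalisation and absolute sum multiply
  to at most \<open>16 * V * (\<rho> - r) * sqrt 2 ^ r + 8 * T * \<rho>\<close>. The first part sums
  to the order of \<open>sqrt 2 ^ \<rho>\<close>, the second costs only a squared logarithm.\<close>

lemma sum_threshold_coeff_le:
  fixes u v :: "nat \<Rightarrow> real" and n :: nat
  defines "T \<equiv> sqrt (\<Sum>i=1..n. (v i - u i)\<^sup>2)"
  assumes \<rho>: "\<rho> \<le> L" and u: "u \<in> unimodal n" and v: "v \<in> unimodal_at n m" and m: "1 \<le> m" "m \<le> n"
  shows "(\<Sum>\<alpha>\<in>haar_index L. \<bar>\<Sum>i=1..n. haar_vec n L \<alpha> i * (v i - u i)\<bar> * haar_threshold n \<rho> m \<alpha>)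
    \<le> 320 * variation n u * (sqrt 2 ^ \<rho> - 1) + 8 * T * (real \<rho>)\<^sup>2"
proof -
  let ?V = "variation n u"
  let ?d = "\<lambda>r k. \<bar>haar_diff n r k (\<lambda>i. v i - u i)\<bar>"
  let ?K = "\<lambda>r. {k. k < 2 ^ (L - Suc r) \<and> regular n m (2 ^ Suc r) k}"
  have T: "0 \<le> T" by (simp add: T_def sum_nonneg)
  have V: "0 \<le> ?V"
    using variation_bounds[of 1 n u] m by (simp add: variation_def)
  have "(\<Sum>\<alpha>\<in>haar_index L. \<bar>\<Sum>i=1..n. haar_vec n L \<alpha> i * (v i - u i)\<bar> * haar_threshold n \<rho> m \<alpha>)
      = (\<Sum>r\<le>L. \<Sum>k<2 ^ (L - Suc r). ?d r k / sqrt (2 ^ min (Suc r) L) *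
          (if regular n m (2 ^ Suc r) k then 4 * real (\<rho> - r) else 0))"
    by (simp add: sum_haar_index haar_vec_coeff haar_threshold_def del: power_Suc One_nat_def)
  also have "\<dots> = (\<Sum>r\<le>L. 4 * real (\<rho> - r) / sqrt (2 ^ min (Suc r) L) * (\<Sum>k\<in>?K r. ?d r k))"
  proof (intro sum.cong refl)
    fix r
    have "(\<Sum>k<2 ^ (L - Suc r). ?d r k / sqrt (2 ^ min (Suc r) L) *
          (if regular n m (2 ^ Suc r) k then 4 * real (\<rho> - r) else 0)) =
        (\<Sum>k<2 ^ (L - Suc r). if regular n m (2 ^ Suc r) k then
          4 * real (\<rho> - r) / sqrt (2 ^ min (Suc r) L) * ?d r k else 0)"
      by (intro sum.cong) auto
    also have "\<dots> = (\<Sum>k\<in>?K r. 4 * real (\<rho> - r) / sqrt (2 ^ min (Suc r) L) * ?d r k)"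
      by (subst sum.inter_filter[symmetric]) (auto intro: sum.cong)
    finally show "(\<Sum>k<2 ^ (L - Suc r). ?d r k / sqrt (2 ^ min (Suc r) L) *
          (if regular n m (2 ^ Suc r) k then 4 * real (\<rho> - r) else 0)) =
        4 * real (\<rho> - r) / sqrt (2 ^ min (Suc r) L) * (\<Sum>k\<in>?K r. ?d r k)"
      by (simp add: sum_distrib_left)
  qed
  \<comment> \<open>For \<open>r < \<rho> \<le> L\<close> the minimum is \<open>Suc r\<close>; the
    levels from \<open>\<rho>\<close> on, including the scaling function, have threshold
    zero.\<close>
  also have "\<dots> = (\<Sum>r<\<rho>. 4 * real (\<rho> - r) / sqrt (2 ^ Suc r) * (\<Sum>k\<in>?K r. ?d r k))"
    using \<rho> by (intro sum.mono_neutral_cong_right) (auto simp: min_def)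
  also have "\<dots> \<le> (\<Sum>r<\<rho>. 16 * ?V * (real (\<rho> - r) * sqrt 2 ^ r) + 8 * T * \<rho>)"
  proof (intro sum_mono)
    fix r assume r: "r \<in> {..<\<rho>}"
    let ?q = "sqrt (2 ^ Suc r)"
    have q: "2 ^ r / ?q \<le> sqrt 2 ^ r" "2 ^ r / (?q * ?q) = 1 / (2::real)" "0 < ?q"
    proof -
      have "2 ^ r = sqrt 2 ^ r * sqrt 2 ^ r" by (simp flip: power_mult_distrib)
      moreover have "?q = sqrt 2 * sqrt 2 ^ r" by (simp add: real_sqrt_mult real_sqrt_power)
      ultimately have "2 ^ r / ?q = sqrt 2 ^ r / sqrt 2" by simp
      also have "\<dots> \<le> sqrt 2 ^ r / 1" by (intro divide_left_mono) auto
      finally show "2 ^ r / ?q \<le> sqrt 2 ^ r" by simp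
    qed auto
    have "4 * real (\<rho> - r) / ?q * (\<Sum>k\<in>?K r. ?d r k) \<le>
        4 * real (\<rho> - r) / ?q * (2 ^ r * (4 * ?V + 4 * T / ?q))"
      using sum_abs_haar_diff_regular_le[OF u v m, where M = "2 ^ (L - Suc r)" and r = r]
      unfolding T_def by (intro mult_left_mono) auto
    also have "\<dots> = 16 * real (\<rho> - r) * ?V * (2 ^ r / ?q) + 16 * real (\<rho> - r) * T * (2 ^ r / (?q * ?q))"
      using q(3) by (simp add: field_simps del: power_Suc)
    also have "\<dots> = 16 * real (\<rho> - r) * ?V * (2 ^ r / ?q) + 8 * real (\<rho> - r) * T"
      unfolding q(2) by simp
    also have "\<dots> \<le> 16 * real (\<rho> - r) * ?V * sqrt 2 ^ r + 8 * real \<rho> * T"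
      using V T q by (intro add_mono mult_left_mono mult_right_mono) auto
    finally show "4 * real (\<rho> - r) / ?q * (\<Sum>k\<in>?K r. ?d r k) \<le> 16 * ?V * (real (\<rho> - r) * sqrt 2 ^ r) + 8 * T * \<rho>"
      by (simp add: mult_ac)
  qed
  also have "\<dots> = 16 * ?V * (\<Sum>r<\<rho>. real (\<rho> - r) * sqrt 2 ^ r) + 8 * T * (real \<rho>)\<^sup>2"
    by (simp add: sum.distrib sum_distrib_left power2_eq_square)
  also have "\<dots> \<le> 16 * ?V * (20 * (sqrt 2 ^ \<rho> - 1)) + 8 * T * (real \<rho>)\<^sup>2"
    using V sum_linear_geometric_sqrt2 by (intro add_right_mono mult_left_mono) auto
  also have "\<dots> = 320 * ?V * (sqrt 2 ^ \<rho> - 1) + 8 * T * (real \<rho>)\<^sup>2"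
    by (simp add: algebra_simps)
  finally show ?thesis .
qed

lemma inner_le_threshold:
  fixes e :: "'a \<Rightarrow> 'b \<Rightarrow> real" and \<xi> w :: "'b \<Rightarrow> real"
  assumes \<sigma>: "0 < \<sigma>"
    and parseval: "\<And>f g :: 'b \<Rightarrow> real. (\<Sum>i\<in>I. f i * g i) =
      (\<Sum>\<alpha>\<in>\<Lambda>. (\<Sum>i\<in>I. e \<alpha> i * f i) * (\<Sum>i\<in>I. e \<alpha> i * g i))"
    and G: "(\<Sum>\<alpha>\<in>\<Lambda>. (max 0 (\<bar>(\<Sum>i\<in>I. e \<alpha> i * \<xi> i) / \<sigma>\<bar> - s \<alpha>))\<^sup>2) \<le> G\<^sup>2" "0 \<le> G"
  shows "(\<Sum>i\<in>I. \<xi> i * w i) \<le>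
    \<sigma> * ((\<Sum>\<alpha>\<in>\<Lambda>. \<bar>\<Sum>i\<in>I. e \<alpha> i * w i\<bar> * s \<alpha>) + sqrt (\<Sum>i\<in>I. (w i)\<^sup>2) * G)"
proof -
  define z where "z \<alpha> = (\<Sum>i\<in>I. e \<alpha> i * \<xi> i) / \<sigma>" for \<alpha>
  define c where "c \<alpha> = (\<Sum>i\<in>I. e \<alpha> i * w i)" for \<alpha>
  define p where "p \<alpha> = max 0 (\<bar>z \<alpha>\<bar> - s \<alpha>)" for \<alpha>
  have c2: "(\<Sum>\<alpha>\<in>\<Lambda>. (c \<alpha>)\<^sup>2) = (\<Sum>i\<in>I. (w i)\<^sup>2)"
    using parseval[of w w] by (simp add: power2_eq_square c_def)
  have "(\<Sum>i\<in>I. \<xi> i * w i) = \<sigma> * (\<Sum>\<alpha>\<in>\<Lambda>. z \<alpha> * c \<alpha>)"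
    using \<sigma> by (subst parseval) (simp add: z_def c_def sum_distrib_left)
  also have "\<dots> \<le> \<sigma> * (\<Sum>\<alpha>\<in>\<Lambda>. \<bar>c \<alpha>\<bar> * s \<alpha> + \<bar>c \<alpha>\<bar> * \<bar>p \<alpha>\<bar>)"
  proof (intro mult_left_mono sum_mono)
    fix \<alpha>
    have "z \<alpha> * c \<alpha> \<le> \<bar>c \<alpha>\<bar> * \<bar>z \<alpha>\<bar>"
      by (metis abs_ge_self abs_mult mult.commute)
    also have "\<dots> \<le> \<bar>c \<alpha>\<bar> * (s \<alpha> + \<bar>p \<alpha>\<bar>)"
      by (intro mult_left_mono) (auto simp: p_def)
    finally show "z \<alpha> * c \<alpha> \<le> \<bar>c \<alpha>\<bar> * s \<alpha> + \<bar>c \<alpha>\<bar> * \<bar>p \<alpha>\<bar>"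
      by (simp add: distrib_left)
  qed (use \<sigma> in auto)
  also have "\<dots> \<le> \<sigma> * ((\<Sum>\<alpha>\<in>\<Lambda>. \<bar>c \<alpha>\<bar> * s \<alpha>) + L2_set c \<Lambda> * L2_set p \<Lambda>)"
    using \<sigma> L2_set_mult_ineq[of c p \<Lambda>] by (simp add: sum.distrib)
  also have "\<dots> \<le> \<sigma> * ((\<Sum>\<alpha>\<in>\<Lambda>. \<bar>c \<alpha>\<bar> * s \<alpha>) + L2_set c \<Lambda> * G)"
  proof -
    have "L2_set p \<Lambda> \<le> G"
      using G unfolding L2_set_def p_def z_def by (intro real_le_lsqrt) (auto intro: sum_nonneg)
    thus ?thesis using \<sigma> by (intro mult_left_mono add_left_mono) auto
  qed
  finally show ?thesis unfolding L2_set_def c2 by (simp only: c_def)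
qed

lemma exp_neg_square_le: "exp (- (4 * real q)\<^sup>2 / 8) \<le> (1 / 4) ^ q"
proof -
  have "real q \<le> real q * real q" by (cases q) auto
  hence "exp (- (4 * real q)\<^sup>2 / 8) \<le> exp (real q * (- 2))"
    by (simp add: power2_eq_square)
  also have "\<dots> = exp (- 2) ^ q" by (rule exp_of_nat_mult)
  also have "\<dots> \<le> (1 / 4) ^ q"
  proof (rule power_mono)
    have "(2::real)\<^sup>2 \<le> (exp 1)\<^sup>2"
      using exp_ge_add_one_self[of "1::real"] by (intro power_mono) auto
    hence "(4::real) \<le> exp 2" by (simp flip: exp_of_nat_mult add: power2_eq_square exp_add[symmetric])
    thus "exp (- 2) \<le> (1 / 4 :: real)" by (simp add: exp_minus field_simps)
  qed simp
  finally show ?thesis .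
qed

text \<open>The terms double while \<open>r < \<rho>\<close> and halve afterwards, so the sum has
  the size of its peak. The rising part has a closed form; on the falling part the induction carries
  the remainder \<open>(1/2) ^ L\<close>.\<close>

lemma sum_half_quarter_powers_le: "(\<Sum>r<L. (1/2) ^ Suc r * (1/4) ^ (\<rho> - r)) \<le> 2 * (1/2 :: real) ^ \<rho>"
proof -
  have below: "(\<Sum>r<L. (1/2) ^ Suc r * (1/4) ^ (\<rho> - r)) = (1/4) ^ \<rho> * (2 ^ L - 1) / (2::real)" if "L \<le> \<rho>" for L
    using that
  proof (induction L)
    case (Suc L)
    have "(1/4::real) ^ \<rho> = (1/4) ^ (\<rho> - L) * (1/4) ^ L"
      using Suc by (simp flip: power_add)
    also have "\<dots> * 2 ^ L = (1/4) ^ (\<rho> - L) * (1/2) ^ L"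
      by (simp add: mult.assoc flip: power_mult_distrib)
    finally show ?case using Suc by (simp add: algebra_simps)
  qed simp
  have half: "(1/4) ^ \<rho> * 2 ^ \<rho> = (1/2::real) ^ \<rho>"
    by (simp flip: power_mult_distrib)
  have above: "(\<Sum>r<L. (1/2) ^ Suc r * (1/4) ^ (\<rho> - r)) \<le> 2 * (1/2) ^ \<rho> - (1/2::real) ^ L" if "\<rho> \<le> L" for L
    using that
  proof (induction L rule: dec_induct)
    case base
    have *: "(q - p * 1) / 2 \<le> q" if "0 \<le> p" "0 \<le> q" for p q :: real
      using that by simp
    have "(1/4) ^ \<rho> * (2 ^ \<rho> - 1) / 2 \<le> (1/2::real) ^ \<rho>"
      unfolding right_diff_distrib half by (rule *) simp_all
    thus ?case using below[of \<rho>] by simp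
  qed simp
  show ?thesis
  proof (cases "\<rho> \<le> L")
    case True
    have "0 \<le> (1/2::real) ^ L" by simp
    thus ?thesis using above[OF True] by linarith
  next
    case False
    have "(2::real) ^ L \<le> 2 ^ \<rho>" using False by (intro power_increasing) auto
    hence "(2::real) ^ L - 1 \<le> 2 ^ \<rho>" by linarith
    hence "(1/4::real) ^ \<rho> * (2 ^ L - 1) \<le> (1/2) ^ \<rho>"
      unfolding half[symmetric] by (rule mult_left_mono) simp
    moreover have "p / 2 \<le> 2 * q" if "p \<le> q" "0 \<le> q" for p q :: real
      using that by simp
    ultimately have "(1/4) ^ \<rho> * (2 ^ L - 1) / 2 \<le> 2 * (1/2 :: real) ^ \<rho>"
      by (metis zero_le_power zero_le_divide_1_iff zero_le_numeral)
    thus ?thesis using False below[of L] by simp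
  qed
qed

text \<open>Each of the \<open>L + 1\<close> levels has at most six irregular terms, all equal to 1.
  The regular terms add up to about the number of blocks of length
  \<open>2 ^ \<rho>\<close>.\<close>

lemma sum_exp_threshold_le:
  "(\<Sum>\<alpha>\<in>haar_index L. exp (- (haar_threshold n \<rho> m \<alpha>)\<^sup>2 / 8)) \<le>
    6 * (real L + 1) + 1 + 2 * (2 ^ L / 2 ^ \<rho>)"
proof -
  let ?t = "\<lambda>r k. exp (- (haar_threshold n \<rho> m (r, k))\<^sup>2 / 8)"
  have "(\<Sum>\<alpha>\<in>haar_index L. exp (- (haar_threshold n \<rho> m \<alpha>)\<^sup>2 / 8)) =
      (\<Sum>r\<le>L. \<Sum>k<2 ^ (L - Suc r). ?t r k)"
    by (rule sum_haar_index)
  also have "\<dots> \<le> (\<Sum>r\<le>L. 6 + 2 ^ (L - Suc r) * (1 / 4) ^ (\<rho> - r))"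
  proof (intro sum_mono)
    fix r
    let ?irr = "{k. \<not> regular n m (2 ^ Suc r) k}"
    have irr: "finite ?irr" "card ?irr \<le> 6"
      using card_irregular_le[of "2 ^ Suc r" n m] by auto
    have "(\<Sum>k<2 ^ (L - Suc r). ?t r k) \<le>
        (\<Sum>k<2 ^ (L - Suc r). of_bool (k \<in> ?irr) + (1 / 4) ^ (\<rho> - r))"
      using exp_neg_square_le[of "\<rho> - r"]
      by (intro sum_mono) (auto simp: haar_threshold_def simp del: power_Suc)
    also have "\<dots> = real (card ({..<2 ^ (L - Suc r)} \<inter> ?irr)) + 2 ^ (L - Suc r) * (1 / 4) ^ (\<rho> - r)"
      by (simp add: sum.distrib of_bool_def sum.If_cases Int_def del: power_Suc)
    also have "\<dots> \<le> 6 + 2 ^ (L - Suc r) * (1 / 4) ^ (\<rho> - r)"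
      using irr card_mono[OF irr(1), of "{..<2 ^ (L - Suc r)} \<inter> ?irr"] by simp
    finally show "(\<Sum>k<2 ^ (L - Suc r). ?t r k) \<le> 6 + 2 ^ (L - Suc r) * (1 / 4) ^ (\<rho> - r)" .
  qed
  \<comment> \<open>Level \<open>L\<close> is split off: it has one index because
    \<open>L - Suc L = 0\<close>, and it supplies the separate \<open>+ 1\<close>.\<close>
  also have "\<dots> = 6 * (real L + 1) + (1 / 4) ^ (\<rho> - L) + (\<Sum>r<L. 2 ^ (L - Suc r) * (1 / 4) ^ (\<rho> - r))"
    by (simp add: sum.distrib flip: lessThan_Suc_atMost)
  also have "(\<Sum>r<L. 2 ^ (L - Suc r) * (1 / 4) ^ (\<rho> - r)) = 2 ^ L * (\<Sum>r<L. (1/2) ^ Suc r * (1/4 :: real) ^ (\<rho> - r))"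
    unfolding sum_distrib_left
  proof (intro sum.cong refl)
    fix r assume "r \<in> {..<L}"
    hence "(2::real) ^ (L - Suc r) = 2 ^ L * (1/2) ^ Suc r"
      by (subst power_diff) (auto simp: power_divide)
    thus "2 ^ (L - Suc r) * (1 / 4) ^ (\<rho> - r) = 2 ^ L * ((1/2) ^ Suc r * (1/4 :: real) ^ (\<rho> - r))"
      by simp
  qed
  also have "\<dots> \<le> 2 ^ L * (2 * (1/2) ^ \<rho>)"
    using sum_half_quarter_powers_le by (intro mult_left_mono) auto
  also have "(1 / 4 :: real) ^ (\<rho> - L) \<le> 1"
    by (intro power_le_one) auto
  finally show ?thesis by (simp add: power_divide mult.commute)
qed

section \<open>Thresholded Gaussian coefficients\<close>

text \<open>Beyond the threshold,
  \<open>(\<bar>z\<bar> - s)\<^sup>2 \<le> z\<^sup>2 - s\<^sup>2\<close>. The right-hand side has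
  the form \<open>1 + \<kappa> * exp (z\<^sup>2 / 8)\<close> whose products have a controlled
  expectation.\<close>

lemma exp_truncated_square_le:
  fixes s z :: real
  assumes "0 \<le> s"
  shows "exp ((max 0 (\<bar>z\<bar> - s))\<^sup>2 / 8) \<le> 1 + exp (- s\<^sup>2 / 8) * exp (z\<^sup>2 / 8)"
proof (cases "\<bar>z\<bar> \<le> s")
  case False
  have "(\<bar>z\<bar> - s)\<^sup>2 \<le> z\<^sup>2 - s\<^sup>2"
  proof -
    have "0 \<le> 2 * s * (\<bar>z\<bar> - s)" using assms False by simp
    moreover have "z\<^sup>2 = \<bar>z\<bar>\<^sup>2" by simp
    ultimately show ?thesis by (simp add: power2_eq_square algebra_simps)
  qed
  hence "exp ((max 0 (\<bar>z\<bar> - s))\<^sup>2 / 8) \<le> exp (- s\<^sup>2 / 8 + z\<^sup>2 / 8)"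
    using False by (simp add: max_def)
  also have "\<dots> \<le> 1 + exp (- s\<^sup>2 / 8) * exp (z\<^sup>2 / 8)"
    unfolding exp_add by simp
  finally show ?thesis .
qed simp

text \<open>Markov's inequality for the sum \<open>H\<close> of the majorants \<open>F m\<close>. A
  single event defined through \<open>H\<close> serves all \<open>m\<close> at once, at the price of
  \<open>ln (card M)\<close>.\<close>

lemma gaussian_threshold_event:
  fixes e :: "'a \<Rightarrow> 'b \<Rightarrow> real" and s :: "'c \<Rightarrow> 'a \<Rightarrow> real"
  assumes \<sigma>: "0 < \<sigma>" and fin: "finite \<Lambda>" "finite I" "finite M" "M \<noteq> {}"
    and bessel: "\<And>f :: 'b \<Rightarrow> real. (\<Sum>\<alpha>\<in>\<Lambda>. (\<Sum>i\<in>I. e \<alpha> i * f i)\<^sup>2) \<le> (\<Sum>i\<in>I. (f i)\<^sup>2)"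
    and s: "\<And>m \<alpha>. 0 \<le> s m \<alpha>"
    and D: "\<And>m. m \<in> M \<Longrightarrow> (\<Sum>\<alpha>\<in>\<Lambda>. exp (- (s m \<alpha>)\<^sup>2 / 8)) \<le> D"
  defines "N \<equiv> \<Pi>\<^sub>M i\<in>I. centred_normal \<sigma>"
  shows "\<exists>A\<in>sets N. 1 - exp (- x) \<le> measure N A \<and> (\<forall>\<xi>\<in>A. \<forall>m\<in>M.
    (\<Sum>\<alpha>\<in>\<Lambda>. (max 0 (\<bar>(\<Sum>i\<in>I. e \<alpha> i * \<xi> i) / \<sigma>\<bar> - s m \<alpha>))\<^sup>2) \<le> 8 * (x + ln (card M) + 2 * D))"
proof -
  interpret N: product_prob_space "\<lambda>i. centred_normal \<sigma>" I
    using \<sigma> by (intro product_prob_space_normal)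
  interpret P: prob_space N unfolding N_def using \<sigma> by (intro prob_space_PiM prob_space_normal_density)
  define z where "z \<alpha> \<xi> = (\<Sum>i\<in>I. e \<alpha> i * \<xi> i) / \<sigma>" for \<alpha> \<xi>
  define F where "F m \<xi> = (\<Prod>\<alpha>\<in>\<Lambda>. 1 + exp (- (s m \<alpha>)\<^sup>2 / 8) * exp ((z \<alpha> \<xi>)\<^sup>2 / 8))" for m \<xi>
  define H where "H \<xi> = (\<Sum>m\<in>M. F m \<xi>)" for \<xi>
  \<comment> \<open>\<open>B\<close> is \<open>exp x\<close> times the bound on the expectation of
    \<open>H\<close>, so \<open>H\<close> exceeds it with probability at most
    \<open>exp (- x)\<close>.\<close>
  define B where "B = real (card M) * exp (2 * D + x)"
  define A where "A = {\<xi> \<in> space N. H \<xi> \<le> B}"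
  have card: "0 < real (card M)" using fin by (simp add: card_gt_0_iff)
  have B: "0 < B" using card by (simp add: B_def)
  have F_nonneg: "0 \<le> F m \<xi>" for m \<xi>
    unfolding F_def by (intro prod_nonneg) (auto intro: add_nonneg_nonneg)
  have H_nonneg: "0 \<le> H \<xi>" for \<xi>
    unfolding H_def by (intro sum_nonneg F_nonneg)
  have z_meas [measurable]: "z \<alpha> \<in> borel_measurable N" for \<alpha>
    unfolding z_def N_def by measurable
  have F_meas [measurable]: "F m \<in> borel_measurable N" for m
    unfolding F_def by measurable
  have H_meas [measurable]: "H \<in> borel_measurable N"
    unfolding H_def by measurable
  have A_sets [measurable]: "A \<in> sets N"
    unfolding A_def by measurable
  have "(\<integral>\<^sup>+ \<xi>. ennreal (H \<xi>) \<partial>N) = (\<integral>\<^sup>+ \<xi>. (\<Sum>m\<in>M. ennreal (F m \<xi>)) \<partial>N)"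
    unfolding H_def using F_nonneg by (intro nn_integral_cong) (simp add: sum_ennreal)
  also have "\<dots> = (\<Sum>m\<in>M. \<integral>\<^sup>+ \<xi>. ennreal (F m \<xi>) \<partial>N)"
    by (subst nn_integral_sum) auto
  also have "\<dots> \<le> (\<Sum>m\<in>M. ennreal (exp (2 * D)))"
  proof (intro sum_mono)
    fix m assume m: "m \<in> M"
    have "(\<integral>\<^sup>+ \<xi>. ennreal (F m \<xi>) \<partial>N) \<le> ennreal (exp (2 * (\<Sum>\<alpha>\<in>\<Lambda>. exp (- (s m \<alpha>)\<^sup>2 / 8))))"
      unfolding F_def z_def N_def
      using \<sigma> fin bessel by (intro nn_integral_prod_one_plus_exp_square_le) auto
    also have "\<dots> \<le> ennreal (exp (2 * D))"
      using D[OF m] by (intro ennreal_leI) simp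
    finally show "(\<integral>\<^sup>+ \<xi>. ennreal (F m \<xi>) \<partial>N) \<le> ennreal (exp (2 * D))" .
  qed
  also have "\<dots> = ennreal (real (card M) * exp (2 * D))"
    using card by (simp add: ennreal_mult ennreal_of_nat_eq_real_of_nat)
  finally have EH: "(\<integral>\<^sup>+ \<xi>. ennreal (H \<xi>) \<partial>N) \<le> ennreal (real (card M) * exp (2 * D))" .
  have "emeasure N (space N - A) \<le> emeasure N {\<xi> \<in> space N. 1 \<le> ennreal (1 / B) * ennreal (H \<xi>)}"
  proof (intro emeasure_mono)
    show "space N - A \<subseteq> {\<xi> \<in> space N. 1 \<le> ennreal (1 / B) * ennreal (H \<xi>)}"
      using B H_nonneg by (auto simp: A_def field_simps simp flip: ennreal_mult)
  qed measurable
  also have "\<dots> \<le> ennreal (1 / B) * (\<integral>\<^sup>+ \<xi>. ennreal (H \<xi>) * indicator (space N) \<xi> \<partial>N)"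
    by (intro nn_integral_Markov_inequality) auto
  also have "(\<integral>\<^sup>+ \<xi>. ennreal (H \<xi>) * indicator (space N) \<xi> \<partial>N) = (\<integral>\<^sup>+ \<xi>. ennreal (H \<xi>) \<partial>N)"
    by (intro nn_integral_cong) auto
  also have "ennreal (1 / B) * \<dots> \<le> ennreal (1 / B) * ennreal (real (card M) * exp (2 * D))"
    using EH by (intro mult_left_mono) auto
  also have "\<dots> = ennreal (exp (- x))"
    using B card by (simp add: B_def exp_add exp_minus field_simps flip: ennreal_mult)
  finally have "P.prob (space N - A) \<le> exp (- x)"
    by (simp add: P.emeasure_eq_measure)
  hence "1 - exp (- x) \<le> P.prob A"
    using P.prob_compl[OF A_sets] by simp
  moreover have "(\<Sum>\<alpha>\<in>\<Lambda>. (max 0 (\<bar>z \<alpha> \<xi>\<bar> - s m \<alpha>))\<^sup>2) \<le> 8 * (x + ln (card M) + 2 * D)"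
    if "\<xi> \<in> A" "m \<in> M" for \<xi> m
  proof -
    let ?G = "\<Sum>\<alpha>\<in>\<Lambda>. (max 0 (\<bar>z \<alpha> \<xi>\<bar> - s m \<alpha>))\<^sup>2"
    have "exp (?G / 8) = (\<Prod>\<alpha>\<in>\<Lambda>. exp ((max 0 (\<bar>z \<alpha> \<xi>\<bar> - s m \<alpha>))\<^sup>2 / 8))"
      using fin by (simp add: exp_sum sum_divide_distrib)
    also have "\<dots> \<le> F m \<xi>"
      unfolding F_def using s by (intro prod_mono conjI exp_truncated_square_le) auto
    also have "\<dots> \<le> H \<xi>"
      unfolding H_def using fin that F_nonneg by (intro member_le_sum) auto
    also have "\<dots> \<le> B" using that by (simp add: A_def)
    also have "B = exp (ln (card M) + (2 * D + x))"
      using card by (simp add: B_def exp_add)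
    finally show ?thesis by simp
  qed
  ultimately show ?thesis
    using A_sets unfolding z_def by blast
qed

section \<open>The oracle inequality\<close>

text \<open>From \<open>1 + t \<le> exp t\<close> at \<open>t = L / 12 * ln 2\<close> follows
  \<open>1 + L \<le> 24 * 2 powr (L / 12)\<close>, which is squared. The exponent 1/6 is the slack
  available later: \<open>n powr (1 / 6) = sqrt n * n powr (- 1 / 3)\<close>.\<close>

lemma log_square_le_sixth_root:
  assumes n: "1 \<le> n" and L: "(2::real) ^ L \<le> 2 * real n"
  shows "(1 + real L)\<^sup>2 \<le> 1152 * real n powr (1 / 6)"
proof -
  have ln2: "1 / 2 \<le> ln (2::real)" using ln2_ge_two_thirds by simp
  have "1 + real L / 24 \<le> 1 + real L / 12 * ln 2"
    using mult_left_mono[OF ln2, of "real L / 12"] by simp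
  also have "\<dots> \<le> exp (real L / 12 * ln 2)" by (rule exp_ge_add_one_self)
  also have "\<dots> = 2 powr (real L / 12)" by (simp add: powr_def)
  finally have "1 + real L \<le> 24 * 2 powr (real L / 12)" by simp
  hence "(1 + real L)\<^sup>2 \<le> (24 * 2 powr (real L / 12))\<^sup>2"
    by (intro power_mono) auto
  also have "\<dots> = 576 * (2 powr (real L / 12) * 2 powr (real L / 12))"
    by (simp add: power2_eq_square)
  also have "2 powr (real L / 12) * 2 powr (real L / 12) = ((2::real) ^ L) powr (1 / 6)"
    by (simp add: powr_powr flip: powr_add powr_realpow)
  also have "576 * ((2::real) ^ L) powr (1 / 6) \<le> 576 * (2 * real n) powr (1 / 6)"
    using L by (intro mult_left_mono powr_mono2) auto
  also have "(2 * real n) powr (1 / 6) = 2 powr (1 / 6) * real n powr (1 / 6)"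
    by (simp add: powr_mult)
  also have "576 * (2 powr (1 / 6) * real n powr (1 / 6)) \<le> 576 * (2 powr 1 * real n powr (1 / 6))"
    by (intro mult_left_mono mult_right_mono powr_mono) auto
  finally show ?thesis by simp
qed

lemma snorm_eq_L2_set: "snorm n f = L2_set f {1..n} / sqrt n"
  by (simp add: snorm_def L2_set_def real_sqrt_mult real_sqrt_divide)

lemma snorm_nonneg: "0 \<le> snorm n f"
  by (simp add: snorm_eq_L2_set)

lemma snorm_triangle: "snorm n (\<lambda>i. f i + g i) \<le> snorm n f + snorm n g"
  unfolding snorm_eq_L2_set add_divide_distrib[symmetric]
  by (intro divide_right_mono L2_set_triangle_ineq) simp

lemma snorm_minus_commute: "snorm n (\<lambda>i. f i - g i) = snorm n (\<lambda>i. g i - f i)"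
  by (simp add: snorm_def power2_commute)

lemma snorm_squared: "(snorm n f)\<^sup>2 = (\<Sum>i=1..n. (f i)\<^sup>2) / n"
  by (simp add: snorm_def sum_nonneg)

lemma lse_basic_inequality:
  fixes \<mu> \<xi> :: "nat \<Rightarrow> real"
  assumes n: "1 \<le> n" and lse: "is_lse n K est" and u: "u \<in> K"
  defines "y \<equiv> \<lambda>i\<in>{1..n}. \<mu> i + \<xi> i"
  shows "(snorm n (\<lambda>i. est y i - \<mu> i))\<^sup>2 \<le>
    (snorm n (\<lambda>i. u i - \<mu> i))\<^sup>2 + 2 * ((\<Sum>i=1..n. \<xi> i * (est y i - u i)) / n)"
proof -
  have "y \<in> rvec n" by (simp add: y_def rvec_def)
  hence "is_arg_min (\<lambda>v. (snorm n (\<lambda>i. y i - v i))\<^sup>2) (\<lambda>v. v \<in> K) (est y)"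
    using lse by (simp add: is_lse_def)
  hence "(snorm n (\<lambda>i. y i - est y i))\<^sup>2 \<le> (snorm n (\<lambda>i. y i - u i))\<^sup>2"
    using u by (auto simp: is_arg_min_def not_less)
  hence "(\<Sum>i=1..n. (y i - est y i)\<^sup>2) \<le> (\<Sum>i=1..n. (y i - u i)\<^sup>2)"
    using n by (simp add: snorm_squared divide_le_cancel)
  \<comment> \<open>The middle sum is free of \<open>w\<close> and cancels between the estimator and
    the competitor.\<close>
  moreover have "(\<Sum>i=1..n. (y i - w i)\<^sup>2) =
      (\<Sum>i=1..n. (w i - \<mu> i)\<^sup>2) + (\<Sum>i=1..n. (\<xi> i)\<^sup>2 + 2 * \<xi> i * \<mu> i) - 2 * (\<Sum>i=1..n. \<xi> i * w i)" for w
    unfolding sum_distrib_left sum.distrib[symmetric] sum_subtractf[symmetric]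
    by (intro sum.cong) (auto simp: y_def power2_eq_square algebra_simps)
  moreover have "(\<Sum>i=1..n. \<xi> i * (est y i - u i)) = (\<Sum>i=1..n. \<xi> i * est y i) - (\<Sum>i=1..n. \<xi> i * u i)"
    by (simp add: right_diff_distrib sum_subtractf)
  ultimately have "(\<Sum>i=1..n. (est y i - \<mu> i)\<^sup>2) \<le>
      (\<Sum>i=1..n. (u i - \<mu> i)\<^sup>2) + 2 * (\<Sum>i=1..n. \<xi> i * (est y i - u i))"
    by simp
  thus ?thesis
    using n by (simp add: snorm_squared field_simps)
qed

section \<open>Choice of scales and the uniform noise bound\<close>

lemma ex_dyadic_scale:
  assumes "1 \<le> n"
  obtains L where "n \<le> 2 ^ L" "(2::real) ^ L \<le> 2 * real n"
proof -
  define L where "L = (LEAST L. n \<le> 2 ^ L)"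
  have "\<exists>L. n \<le> 2 ^ L" using less_exp less_imp_le by blast
  hence 1: "n \<le> 2 ^ L" unfolding L_def by (rule LeastI_ex)
  have "2 ^ L \<le> 2 * n"
  proof (cases L)
    case (Suc q)
    have "\<not> n \<le> 2 ^ q" using not_less_Least[of q "\<lambda>L. n \<le> 2 ^ L"] Suc by (simp add: L_def)
    thus ?thesis using Suc by simp
  qed (use assms in simp)
  hence "real (2 ^ L) \<le> real (2 * n)" by (rule of_nat_mono)
  thus ?thesis using 1 that by simp
qed

text \<open>The least admissible exponent overshoots by at most a factor \<open>sqrt 2\<close>. The
  \<open>- 1\<close> keeps the upper bound valid at \<open>\<rho> = 0\<close>, where
  \<open>\<delta>\<close> may exceed \<open>sqrt 2\<close>.\<close>

lemma ex_resolution: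
  fixes \<delta> :: real
  assumes \<delta>: "0 < \<delta>" and L: "1 / \<delta> \<le> sqrt 2 ^ L"
  obtains \<rho> where "\<rho> \<le> L" "1 / \<delta> \<le> sqrt 2 ^ \<rho>" "sqrt 2 ^ \<rho> - 1 \<le> sqrt 2 / \<delta>"
proof -
  define \<rho> where "\<rho> = (LEAST \<rho>. 1 / \<delta> \<le> sqrt 2 ^ \<rho>)"
  have 1: "1 / \<delta> \<le> sqrt 2 ^ \<rho>" unfolding \<rho>_def using L by (rule LeastI)
  have 2: "\<rho> \<le> L" unfolding \<rho>_def using L by (rule Least_le)
  have "sqrt 2 ^ \<rho> - 1 \<le> sqrt 2 / \<delta>"
  proof (cases \<rho>)
    case 0
    thus ?thesis using \<delta> by simp
  next
    case (Suc q)
    hence "sqrt 2 ^ q < 1 / \<delta>"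
      using not_less_Least[of q "\<lambda>\<rho>. 1 / \<delta> \<le> sqrt 2 ^ \<rho>"] by (simp add: \<rho>_def)
    hence "sqrt 2 * sqrt 2 ^ q \<le> sqrt 2 * (1 / \<delta>)" by (intro mult_left_mono) auto
    thus ?thesis using Suc by simp
  qed
  thus ?thesis using 1 2 that by blast
qed

text \<open>The resolution \<open>2 ^ \<rho>\<close> of order \<open>1 / \<delta>\<^sup>2\<close> balances the variation term, of order
  \<open>V / (n \<delta>)\<close>, against the number of about \<open>n \<delta>\<^sup>2\<close> untruncated coefficients.\<close>

lemma noise_inner_bound:
  fixes n :: nat and \<sigma> x :: real and u :: "nat \<Rightarrow> real"
  assumes n: "1 \<le> n" and \<sigma>: "0 < \<sigma>" and x: "0 < x" and u: "u \<in> unimodal n"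
  defines "\<delta> \<equiv> ((\<sigma> + variation n u) / (\<sigma> * real n)) powr (1 / 3)"
  shows "with_prob_at_least (gauss n \<sigma>) (1 - exp (- x)) (\<lambda>\<xi>. \<forall>v\<in>unimodal n.
    (\<Sum>i=1..n. \<xi> i * (v i - u i)) / n \<le> 480 * \<sigma>\<^sup>2 * \<delta>\<^sup>2 + snorm n (\<lambda>i. v i - u i) *
      (32264 * \<sigma> * \<delta> + (2 + sqrt 2) * \<sigma> * sqrt (x + ln (exp 1 * real n)) / sqrt n))"
proof -
  define V where "V = variation n u"
  have V: "0 \<le> V"
    using variation_bounds[of 1 n u] n by (simp add: V_def variation_def)
  \<comment> \<open>Dropping \<open>V\<close> shows that the rate \<open>\<delta>\<close> never
    falls below \<open>n powr (- 1 / 3)\<close>; this is what absorbs the logarithms.\<close>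
  have base: "1 / real n \<le> (\<sigma> + V) / (\<sigma> * real n)"
    using \<sigma> V n by (simp add: field_simps)
  hence base_pos: "0 < (\<sigma> + V) / (\<sigma> * real n)"
    using n by (intro less_le_trans[OF _ base]) auto
  have \<delta>: "0 < \<delta>" using base_pos unfolding \<delta>_def V_def powr_gt_zero by linarith
  have \<delta>_cube: "\<delta> ^ 3 = (\<sigma> + V) / (\<sigma> * real n)"
  proof -
    have "(p powr (1 / 3)) ^ 3 = p" if "0 < p" for p :: real
      using that by (simp add: powr_powr flip: powr_realpow)
    thus ?thesis using base_pos unfolding \<delta>_def V_def by blast
  qed
  have \<delta>_ge: "real n powr (- 1 / 3) \<le> \<delta>"
  proof -
    have "real n powr (- 1 / 3) = (1 / real n) powr (1 / 3)"
      using n by (simp add: powr_divide powr_minus_divide)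
    also have "\<dots> \<le> \<delta>"
      unfolding \<delta>_def using base V_def by (intro powr_mono2) auto
    finally show ?thesis .
  qed
  have sqrt_n: "real n powr (1 / 6) \<le> sqrt n * \<delta>"
  proof -
    have "real n powr (1 / 6) = sqrt n * real n powr (- 1 / 3)"
      by (simp add: powr_half_sqrt[symmetric] flip: powr_add)
    also have "\<dots> \<le> sqrt n * \<delta>" using \<delta>_ge by (intro mult_left_mono) auto
    finally show ?thesis .
  qed
  obtain L where L: "n \<le> 2 ^ L" "(2::real) ^ L \<le> 2 * real n"
    using ex_dyadic_scale[OF n] by blast
  have "1 / \<delta> \<le> sqrt 2 ^ L"
  proof -
    have "1 \<le> sqrt n * \<delta>"
      using sqrt_n ge_one_powr_ge_zero[of "real n" "1 / 6"] n by simp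
    hence "1 / \<delta> \<le> sqrt n" using \<delta> by (simp add: field_simps)
    also have "\<dots> \<le> sqrt (2 ^ L)"
      using L(1) by (intro real_sqrt_le_mono) (metis of_nat_le_iff of_nat_numeral of_nat_power)
    finally show ?thesis by (simp add: real_sqrt_power)
  qed
  then obtain \<rho> where \<rho>: "\<rho> \<le> L" "1 / \<delta> \<le> sqrt 2 ^ \<rho>" "sqrt 2 ^ \<rho> - 1 \<le> sqrt 2 / \<delta>"
    using ex_resolution[OF \<delta>] by blast
  define D where "D = 6 * (real L + 1) + 1 + 2 * ((2::real) ^ L / 2 ^ \<rho>)"
  define R where "R = 8 * (x + ln n + 2 * D)"
  let ?s = "haar_threshold n \<rho>" and ?e = "haar_vec n L" and ?\<Lambda> = "haar_index L"
  have "\<exists>A\<in>sets (gauss n \<sigma>). 1 - exp (- x) \<le> measure (gauss n \<sigma>) A \<and> (\<forall>\<xi>\<in>A. \<forall>m\<in>{1..n}.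
    (\<Sum>\<alpha>\<in>?\<Lambda>. (max 0 (\<bar>(\<Sum>i=1..n. ?e \<alpha> i * \<xi> i) / \<sigma>\<bar> - ?s m \<alpha>))\<^sup>2) \<le> 8 * (x + ln (card {1..n}) + 2 * D))"
    unfolding gauss_def
  proof (rule gaussian_threshold_event)
    show "(\<Sum>\<alpha>\<in>?\<Lambda>. (\<Sum>i=1..n. ?e \<alpha> i * f i)\<^sup>2) \<le> (\<Sum>i=1..n. (f i)\<^sup>2)" for f
      using haar_vec_parseval[OF L(1), of f f] by (simp add: power2_eq_square)
    show "0 \<le> ?s m \<alpha>" for m \<alpha> by (simp add: haar_threshold_def split: prod.splits)
    show "(\<Sum>\<alpha>\<in>?\<Lambda>. exp (- (?s m \<alpha>)\<^sup>2 / 8)) \<le> D" for m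
      unfolding D_def by (rule sum_exp_threshold_le)
  qed (use \<sigma> n in auto)
  then obtain A where A: "A \<in> sets (gauss n \<sigma>)" "1 - exp (- x) \<le> measure (gauss n \<sigma>) A"
    and A_bound: "\<And>\<xi> m. \<xi> \<in> A \<Longrightarrow> m \<in> {1..n} \<Longrightarrow>
      (\<Sum>\<alpha>\<in>?\<Lambda>. (max 0 (\<bar>(\<Sum>i=1..n. ?e \<alpha> i * \<xi> i) / \<sigma>\<bar> - ?s m \<alpha>))\<^sup>2) \<le> R"
    unfolding R_def by auto
  define Q where "Q = sqrt (x + ln (exp 1 * real n))"
  have ln_n: "0 \<le> ln (real n)" "ln (exp 1 * real n) = 1 + ln n"
    using n by (auto simp: ln_mult)
  have D0: "0 \<le> D" by (simp add: D_def)
  have R0: "0 \<le> R" using x ln_n D0 by (simp add: R_def)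
  have Q0: "0 \<le> Q" by (simp add: Q_def x ln_n add_nonneg_nonneg less_imp_le)
  \<comment> \<open>Since \<open>2 ^ \<rho> \<ge> 1 / \<delta>\<^sup>2\<close> and
    \<open>2 ^ L \<le> 2 * n\<close>, the last term of \<open>D\<close> is at most
    \<open>(2 * sqrt n * \<delta>)\<^sup>2\<close>. The logarithmic part is at least 1, hence below
    its own square.\<close>
  have sqrt_D: "sqrt D \<le> 6 * real L + 7 + 2 * sqrt n * \<delta>"
  proof (rule real_le_lsqrt)
    have "(1 / \<delta>)\<^sup>2 \<le> (sqrt 2 ^ \<rho>)\<^sup>2" using \<rho> \<delta> by (intro power_mono) auto
    also have "(sqrt 2 ^ \<rho>)\<^sup>2 = 2 ^ \<rho>" by (simp add: power2_eq_square flip: power_mult_distrib)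
    finally have "1 / 2 ^ \<rho> \<le> \<delta>\<^sup>2" using \<delta> by (simp add: field_simps)
    hence "2 ^ L * (1 / 2 ^ \<rho>) \<le> (2 * real n) * \<delta>\<^sup>2"
      using L by (intro mult_mono) auto
    hence "D \<le> 6 * real L + 7 + (2 * sqrt n * \<delta>)\<^sup>2"
      by (simp add: D_def power_mult_distrib)
    also have "\<dots> \<le> (6 * real L + 7)\<^sup>2 + (2 * sqrt n * \<delta>)\<^sup>2"
      by (simp add: power2_eq_square algebra_simps)
    also have "\<dots> \<le> (6 * real L + 7 + 2 * sqrt n * \<delta>)\<^sup>2"
      using \<delta> by (simp add: power2_sum)
    finally show "D \<le> (6 * real L + 7 + 2 * sqrt n * \<delta>)\<^sup>2" .
  qed (use \<delta> in \<open>auto intro: add_nonneg_nonneg\<close>)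
  \<comment> \<open>The union over modes enters through \<open>ln n \<le> ln (exp 1 * n)\<close>.
    The constant \<open>2 + sqrt 2\<close> of the deviation term covers
    \<open>sqrt 8\<close>.\<close>
  have sqrt_R: "sqrt R \<le> (2 + sqrt 2) * Q + 4 * sqrt D"
  proof -
    have "sqrt R \<le> sqrt (8 * (x + ln (exp 1 * real n)) + 16 * D)"
      by (simp add: R_def ln_n)
    also have "\<dots> \<le> sqrt (8 * (x + ln (exp 1 * real n))) + sqrt (16 * D)"
      using x ln_n D0 by (intro sqrt_add_le_add_sqrt) auto
    also have "\<dots> = sqrt 8 * Q + 4 * sqrt D"
      unfolding Q_def real_sqrt_mult by simp
    also have "sqrt 8 \<le> 2 + sqrt 2"
    proof -
      have "sqrt 8 = 2 * sqrt 2" using real_sqrt_mult[of 4 2] by simp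
      moreover have "sqrt 2 \<le> 2" by (rule real_le_lsqrt) auto
      ultimately show ?thesis by simp
    qed
    finally show ?thesis using Q0 by (simp add: mult_right_mono)
  qed
  \<comment> \<open>All logarithmic terms are at most \<open>28 * (1 + L)\<^sup>2\<close>, and
    \<open>32256 = 28 * 1152\<close>.\<close>
  have logs: "8 * (real \<rho>)\<^sup>2 + 4 * (6 * real L + 7) \<le> 32256 * sqrt n * \<delta>"
  proof -
    have *: "8 * a + 4 * (6 * l + 7) \<le> 28 * c" if "a \<le> b" "c = 1 + 2 * l + b" "0 \<le> b" "0 \<le> l" for a b c l :: real
      using that by simp
    have "(real \<rho>)\<^sup>2 \<le> (real L)\<^sup>2" using \<rho> by (intro power_mono) auto
    moreover have "(1 + real L)\<^sup>2 = 1 + 2 * real L + (real L)\<^sup>2" "0 \<le> (real L)\<^sup>2" "0 \<le> real L"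
      by (simp_all add: power2_sum)
    ultimately have "8 * (real \<rho>)\<^sup>2 + 4 * (6 * real L + 7) \<le> 28 * (1 + real L)\<^sup>2"
      by (rule *)
    also have "\<dots> \<le> 28 * (1152 * real n powr (1 / 6))"
      using log_square_le_sixth_root[OF n L(2)] by simp
    also have "\<dots> \<le> 28 * (1152 * (sqrt n * \<delta>))"
      using sqrt_n by simp
    finally show ?thesis by simp
  qed
  show ?thesis
    unfolding with_prob_at_least_def
  proof (intro bexI[OF _ A(1)] conjI A(2) ballI)
    fix \<xi> v assume \<xi>: "\<xi> \<in> A" and "v \<in> unimodal n"
    then obtain m where m: "1 \<le> m" "m \<le> n" and v: "v \<in> unimodal_at n m"
      by (auto simp: unimodal_def)
    define T where "T = sqrt (\<Sum>i=1..n. (v i - u i)\<^sup>2)"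
    define t where "t = snorm n (\<lambda>i. v i - u i)"
    have T: "T = sqrt n * t" "0 \<le> T"
      using n by (simp_all add: T_def t_def snorm_eq_L2_set L2_set_def sum_nonneg)
    have "(\<Sum>i=1..n. \<xi> i * (v i - u i)) \<le>
        \<sigma> * ((\<Sum>\<alpha>\<in>?\<Lambda>. \<bar>\<Sum>i=1..n. ?e \<alpha> i * (v i - u i)\<bar> * ?s m \<alpha>) + T * sqrt R)"
      unfolding T_def
    proof (rule inner_le_threshold[OF \<sigma> haar_vec_parseval[OF L(1)]])
      show "(\<Sum>\<alpha>\<in>?\<Lambda>. (max 0 (\<bar>(\<Sum>i=1..n. ?e \<alpha> i * \<xi> i) / \<sigma>\<bar> - ?s m \<alpha>))\<^sup>2) \<le> (sqrt R)\<^sup>2"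
        using A_bound[OF \<xi>, of m] m R0 by simp
    qed (use R0 in simp)
    also have "\<dots> \<le> \<sigma> * ((320 * V * (sqrt 2 ^ \<rho> - 1) + 8 * T * (real \<rho>)\<^sup>2) + T * sqrt R)"
      using sum_threshold_coeff_le[OF \<rho>(1) u v m] \<sigma> unfolding V_def T_def by simp
    also have "\<dots> \<le> \<sigma> * ((320 * V * (sqrt 2 / \<delta>) + 8 * T * (real \<rho>)\<^sup>2) +
        T * ((2 + sqrt 2) * Q + 4 * (6 * real L + 7 + 2 * sqrt n * \<delta>)))"
      using \<rho>(3) V \<sigma> T sqrt_R sqrt_D by (intro mult_left_mono add_mono) auto
    also have "\<dots> = \<sigma> * (320 * V * (sqrt 2 / \<delta>)) + \<sigma> * T * ((8 * (real \<rho>)\<^sup>2 + 4 * (6 * real L + 7))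
        + 8 * sqrt n * \<delta> + (2 + sqrt 2) * Q)"
      by (simp add: algebra_simps)
    also have "\<dots> \<le> \<sigma> * (480 * (\<sigma> * real n * \<delta>\<^sup>2)) + \<sigma> * T * (32256 * sqrt n * \<delta> + 8 * sqrt n * \<delta> + (2 + sqrt 2) * Q)"
    proof (intro add_mono mult_left_mono)
      \<comment> \<open>One factor of the cube cancels against \<open>1 / \<delta>\<close>, so the
        variation term is of the order of the squared rate.\<close>
      have "V \<le> \<sigma> * real n * \<delta> ^ 3"
        using \<sigma> n unfolding \<delta>_cube by simp
      hence "V / \<delta> \<le> \<sigma> * real n * \<delta>\<^sup>2"
        using \<delta> by (simp add: field_simps power3_eq_cube power2_eq_square)
      moreover have "320 * sqrt 2 \<le> 480"
      proof -
        have "sqrt 2 \<le> 3 / 2" by (rule real_le_lsqrt) (auto simp: power2_eq_square)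
        thus ?thesis by simp
      qed
      ultimately have "(320 * sqrt 2) * (V / \<delta>) \<le> 480 * (\<sigma> * real n * \<delta>\<^sup>2)"
        using V \<delta> by (intro mult_mono) auto
      thus "320 * V * (sqrt 2 / \<delta>) \<le> 480 * (\<sigma> * real n * \<delta>\<^sup>2)" by (simp add: mult_ac)
    qed (use logs \<sigma> T in auto)
    finally have *: "(\<Sum>i=1..n. \<xi> i * (v i - u i)) \<le>
        \<sigma> * (480 * (\<sigma> * real n * \<delta>\<^sup>2)) + \<sigma> * T * (32264 * sqrt n * \<delta> + (2 + sqrt 2) * Q)"
      by (simp add: algebra_simps)
    have "(\<Sum>i=1..n. \<xi> i * (v i - u i)) / n \<le>
        (\<sigma> * (480 * (\<sigma> * real n * \<delta>\<^sup>2)) + \<sigma> * (sqrt n * t) * (32264 * sqrt n * \<delta> + (2 + sqrt 2) * Q)) / n"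
      using divide_right_mono[OF *, of "real n"] by (simp add: T)
    also have "\<dots> = 480 * \<sigma>\<^sup>2 * \<delta>\<^sup>2 + t * (32264 * \<sigma> * \<delta> + (2 + sqrt 2) * \<sigma> * Q / sqrt n)"
    proof -
      have "(\<sigma> * (480 * (\<sigma> * (r * r) * \<delta>\<^sup>2)) + \<sigma> * (r * t) * (32264 * r * \<delta> + (2 + sqrt 2) * Q)) / (r * r) =
          480 * \<sigma>\<^sup>2 * \<delta>\<^sup>2 + t * (32264 * \<sigma> * \<delta> + (2 + sqrt 2) * \<sigma> * Q / r)" if "r \<noteq> 0" for r
        using that by (simp add: field_simps power2_eq_square)
      moreover have "sqrt n * sqrt n = real n" "sqrt n \<noteq> 0" using n by auto
      ultimately show ?thesis by metis
    qed
    finally show "(\<Sum>i=1..n. \<xi> i * (v i - u i)) / n \<le> 480 * \<sigma>\<^sup>2 * \<delta>\<^sup>2 + snorm n (\<lambda>i. v i - u i) *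
      (32264 * \<sigma> * \<delta> + (2 + sqrt 2) * \<sigma> * sqrt (x + ln (exp 1 * real n)) / sqrt n)"
      by (simp add: t_def Q_def)
  qed
qed

section \<open>From the noise bound to the oracle inequality\<close>

lemma with_prob_at_least_mono:
  "with_prob_at_least M p P \<Longrightarrow> (\<And>\<omega>. P \<omega> \<Longrightarrow> Q \<omega>) \<Longrightarrow> with_prob_at_least M p Q"
  by (auto simp: with_prob_at_least_def)

text \<open>If \<open>v\<close> is within \<open>\<sigma> * \<delta>\<close> of \<open>u\<close>,
  the triangle inequality suffices. Otherwise the term
  \<open>480 * \<sigma>\<^sup>2 * \<delta>\<^sup>2\<close> is absorbed into one linear in
  \<open>t\<close>, so \<open>a\<^sup>2 - b\<^sup>2 \<le> 2 * t * B\<close> with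
  \<open>t \<le> a + b\<close>. Dividing by \<open>a + b\<close> keeps the coefficient of
  \<open>b\<close> equal to 1.\<close>

lemma lse_unimodal_oracle_bound:
  fixes n :: nat and \<sigma> x :: real and u \<mu> :: "nat \<Rightarrow> real"
  assumes n: "1 \<le> n" and \<sigma>: "0 < \<sigma>" and x: "0 < x" and lse: "is_lse n (unimodal n) est"
    and u: "u \<in> unimodal n"
  shows "with_prob_at_least (gauss n \<sigma>) (1 - exp (- x)) (\<lambda>\<xi>.
    snorm n (\<lambda>i. est (\<lambda>i\<in>{1..n}. \<mu> i + \<xi> i) i - \<mu> i) \<le> snorm n (\<lambda>i. u i - \<mu> i)
      + 2 * 40000 * \<sigma> * ((\<sigma> + variation n u) / (\<sigma> * real n)) powr (1 / 3)
      + 2 * (2 + sqrt 2) * \<sigma> * sqrt (x + ln (exp 1 * real n)) / sqrt n)"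
  using noise_inner_bound[OF n \<sigma> x u]
proof (rule with_prob_at_least_mono)
  fix \<xi>
  define \<delta> where "\<delta> = ((\<sigma> + variation n u) / (\<sigma> * real n)) powr (1 / 3)"
  define q where "q = (2 + sqrt 2) * \<sigma> * sqrt (x + ln (exp 1 * real n)) / sqrt n"
  define v where "v = est (\<lambda>i\<in>{1..n}. \<mu> i + \<xi> i)"
  define a where "a = snorm n (\<lambda>i. v i - \<mu> i)"
  define b where "b = snorm n (\<lambda>i. u i - \<mu> i)"
  define t where "t = snorm n (\<lambda>i. v i - u i)"
  assume "\<forall>v\<in>unimodal n.
    (\<Sum>i=1..n. \<xi> i * (v i - u i)) / n \<le> 480 * \<sigma>\<^sup>2 * (((\<sigma> + variation n u) / (\<sigma> * real n)) powr (1 / 3))\<^sup>2 + snorm n (\<lambda>i. v i - u i) *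
      (32264 * \<sigma> * ((\<sigma> + variation n u) / (\<sigma> * real n)) powr (1 / 3) + (2 + sqrt 2) * \<sigma> * sqrt (x + ln (exp 1 * real n)) / sqrt n)"
  moreover have "v \<in> unimodal n"
  proof -
    have "(\<lambda>i\<in>{1..n}. \<mu> i + \<xi> i) \<in> rvec n" by (simp add: rvec_def)
    thus ?thesis using lse by (auto simp: is_lse_def is_arg_min_def v_def)
  qed
  ultimately have noise: "(\<Sum>i=1..n. \<xi> i * (v i - u i)) / n \<le> 480 * \<sigma>\<^sup>2 * \<delta>\<^sup>2 + t * (32264 * \<sigma> * \<delta> + q)"
    by (simp add: \<delta>_def t_def q_def)
  have basic: "a\<^sup>2 \<le> b\<^sup>2 + 2 * ((\<Sum>i=1..n. \<xi> i * (v i - u i)) / n)"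
    using lse_basic_inequality[OF n lse u] by (simp add: a_def b_def v_def)
  have nn: "0 \<le> a" "0 \<le> b" "0 \<le> t" "0 \<le> \<delta>" "0 \<le> q"
    using x \<sigma> n by (auto simp: a_def b_def t_def \<delta>_def q_def snorm_nonneg ln_mult intro!: divide_nonneg_nonneg mult_nonneg_nonneg)
  have "a \<le> b + 2 * 40000 * \<sigma> * \<delta> + 2 * q"
  proof (cases "t \<le> \<sigma> * \<delta>")
    case True
    have "a \<le> t + b"
      using snorm_triangle[of n "\<lambda>i. v i - u i" "\<lambda>i. u i - \<mu> i"] by (simp add: a_def b_def t_def)
    moreover have "0 \<le> \<sigma> * \<delta>" using nn \<sigma> by simp
    ultimately show ?thesis using True nn by simp
  next
    case False
    \<comment> \<open>The absorbed constant is \<open>480 + 32264 = 32744\<close>, rounded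
      up.\<close>
    define B where "B = 40000 * \<sigma> * \<delta> + q"
    have B: "0 \<le> B" using nn \<sigma> by (simp add: B_def)
    have "\<sigma> * \<delta> * (\<sigma> * \<delta>) \<le> t * (\<sigma> * \<delta>)"
      using False nn \<sigma> by (intro mult_right_mono) auto
    moreover have "0 \<le> t * (\<sigma> * \<delta>)" using nn \<sigma> by simp
    ultimately have "480 * \<sigma>\<^sup>2 * \<delta>\<^sup>2 + t * (32264 * \<sigma> * \<delta> + q) \<le> t * B"
      by (simp add: B_def power2_eq_square algebra_simps)
    hence "a\<^sup>2 \<le> b\<^sup>2 + 2 * (t * B)" using basic noise by linarith
    also have "t \<le> a + b"
    proof -
      have "t \<le> a + snorm n (\<lambda>i. \<mu> i - u i)"
        using snorm_triangle[of n "\<lambda>i. v i - \<mu> i" "\<lambda>i. \<mu> i - u i"] by (simp add: a_def t_def)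
      thus ?thesis by (simp add: b_def snorm_minus_commute[of n \<mu> u])
    qed
    hence "b\<^sup>2 + 2 * (t * B) \<le> b\<^sup>2 + 2 * ((a + b) * B)"
      using B by (simp add: mult_right_mono)
    finally have "(a + b) * (a - b) \<le> (a + b) * (2 * B)"
      by (simp add: power2_eq_square algebra_simps)
    moreover have "0 < a + b"
    proof -
      have "0 \<le> \<sigma> * \<delta>" using nn \<sigma> by simp
      thus ?thesis using \<open>t \<le> a + b\<close> False by linarith
    qed
    ultimately have "a - b \<le> 2 * B" by simp
    thus ?thesis by (simp add: B_def)
  qed
  moreover have "2 * q = 2 * (2 + sqrt 2) * \<sigma> * sqrt (x + ln (exp 1 * real n)) / sqrt n"
    by (simp only: q_def times_divide_eq_right mult.assoc)
  ultimately show "snorm n (\<lambda>i. est (\<lambda>i\<in>{1..n}. \<mu> i + \<xi> i) i - \<mu> i) \<le> snorm n (\<lambda>i. u i - \<mu> i)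
      + 2 * 40000 * \<sigma> * ((\<sigma> + variation n u) / (\<sigma> * real n)) powr (1 / 3)
      + 2 * (2 + sqrt 2) * \<sigma> * sqrt (x + ln (exp 1 * real n)) / sqrt n"
    unfolding a_def b_def v_def \<delta>_def by simp
qed

theorem theoremA5:
  "\<exists>c::real. c > 0 \<and>
     (\<forall>(n::nat) (\<mu>::nat \<Rightarrow> real) (\<sigma>::real) (est::(nat \<Rightarrow> real) \<Rightarrow> (nat \<Rightarrow> real)) (x::real).
        n \<ge> 1 \<longrightarrow> \<mu> \<in> rvec n \<longrightarrow> \<sigma> > 0 \<longrightarrow> is_lse n (unimodal n) est \<longrightarrow> x > 0 \<longrightarrow>
        with_prob_at_least (gauss n \<sigma>) (1 - exp (- x))
          (\<lambda>\<xi>. let y = (\<lambda>i\<in>{1..n}. \<mu> i + \<xi> i) in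
             snorm n (\<lambda>i. est y i - \<mu> i)
               \<le> (INF u\<in>unimodal n.
                    snorm n (\<lambda>i. u i - \<mu> i)
                      + 2 * c * \<sigma> * ((\<sigma> + variation n u) / (\<sigma> * real n)) powr (1 / 3))
                 + 2 * (2 + sqrt 2) * \<sigma> * sqrt (x + ln (exp 1 * real n)) / sqrt (real n)))"
proof (intro exI[of _ "80000::real"] conjI allI impI)
  fix n :: nat and \<mu> :: "nat \<Rightarrow> real" and \<sigma> x :: real and est
  assume n: "1 \<le> n" and \<sigma>: "0 < \<sigma>" and lse: "is_lse n (unimodal n) est" and x: "0 < x"
  let ?\<delta> = "\<lambda>u. ((\<sigma> + variation n u) / (\<sigma> * real n)) powr (1 / 3)"
  let ?f = "\<lambda>u. snorm n (\<lambda>i. u i - \<mu> i) + 2 * 80000 * \<sigma> * ?\<delta> u"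
  let ?I = "INF u\<in>unimodal n. ?f u"
  \<comment> \<open>Half of the constant 80000, at the smallest possible rate: a slack that every
    \<open>u\<close> can pay.\<close>
  define \<epsilon> where "\<epsilon> = 80000 * \<sigma> * (1 / real n) powr (1 / 3)"
  have "(\<lambda>i\<in>{1..n}. 0) \<in> unimodal n"
    using n by (auto simp: unimodal_def unimodal_at_def rvec_def intro!: bexI[of _ 1])
  hence ne: "unimodal n \<noteq> {}" by blast
  have "?I < ?I + \<epsilon>" using \<sigma> n by (simp add: \<epsilon>_def)
  \<comment> \<open>The near-minimiser depends on \<open>n\<close>, \<open>\<mu>\<close> and
    \<open>\<sigma>\<close> but not on \<open>\<xi>\<close>, so the event belonging to this single
    \<open>u\<close> handles the whole infimum.\<close>
  then obtain u where u: "u \<in> unimodal n" "?f u < ?I + \<epsilon>"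
    using ne cInf_lessD[of "?f ` unimodal n" "?I + \<epsilon>"] by auto
  have "0 \<le> variation n u"
    using variation_bounds[of 1 n u] n by (simp add: variation_def)
  hence "1 / real n \<le> (\<sigma> + variation n u) / (\<sigma> * real n)"
    using \<sigma> n by (simp add: field_simps)
  hence "(1 / real n) powr (1 / 3) \<le> ?\<delta> u"
    by (intro powr_mono2) auto
  hence "\<epsilon> \<le> 80000 * \<sigma> * ?\<delta> u"
    using \<sigma> by (simp add: \<epsilon>_def)
  hence le: "snorm n (\<lambda>i. u i - \<mu> i) + 2 * 40000 * \<sigma> * ?\<delta> u \<le> ?I"
    using u(2) by linarith
  show "with_prob_at_least (gauss n \<sigma>) (1 - exp (- x))
          (\<lambda>\<xi>. let y = (\<lambda>i\<in>{1..n}. \<mu> i + \<xi> i) in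
             snorm n (\<lambda>i. est y i - \<mu> i)
               \<le> ?I + 2 * (2 + sqrt 2) * \<sigma> * sqrt (x + ln (exp 1 * real n)) / sqrt (real n))"
    using lse_unimodal_oracle_bound[OF n \<sigma> x lse u(1), of \<mu>]
  proof (rule with_prob_at_least_mono)
    fix \<xi>
    assume "snorm n (\<lambda>i. est (\<lambda>i\<in>{1..n}. \<mu> i + \<xi> i) i - \<mu> i) \<le> snorm n (\<lambda>i. u i - \<mu> i)
      + 2 * 40000 * \<sigma> * ?\<delta> u + 2 * (2 + sqrt 2) * \<sigma> * sqrt (x + ln (exp 1 * real n)) / sqrt n"
    thus "let y = (\<lambda>i\<in>{1..n}. \<mu> i + \<xi> i) in
             snorm n (\<lambda>i. est y i - \<mu> i)
               \<le> ?I + 2 * (2 + sqrt 2) * \<sigma> * sqrt (x + ln (exp 1 * real n)) / sqrt (real n)"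
      unfolding Let_def using le by linarith
  qed
qed simp

end
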